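(* Let $n\ge2$, let $f_1,\dots,f_N$ be bounded slice monogenic $\mathbb{R}_n$-valued functions on the unit ball $\mathbb{B}\subset\mathbb{R}^{n+1}$, and let $\mathsf{F}(z)=(M_{f_1}(z)\ \cdots\ M_{f_N}(z))\in H^\infty(\mathbb{D})^{2^{n-1}\times N\cdot2^{n-1}}$ be the associated block matrix. Fix any total order on $\mathcal{I}$, with respect to which signs of permutations are computed. Then $$\det\bigl(\mathsf{F}(z)\mathsf{F}^*(z)\bigr)=\sum_S\Biggl|\sum_{(R_1,\dots,R_N)}\mathrm{sgn}(R_1,\dots,R_N)\prod_{j=1}^N m_{R_j}^{C_j}(f_j)\Biggr|^2,$$ where: (i) the outer sum runs over column subsets $S\subseteq\{1,\dots,N\cdot2^{n-1}\}$ with $|S|=2^{n-1}$, decomposed as a disjoint union $S=C_1\sqcup\cdots\sqcup C_N$ in which $C_j\subseteq\mathcal{I}$ records the columns of $S$ lying in block $j$ (so $\sum_j|C_j|=2^{n-1}$); (ii) the inner sum runs over ordered partitions $(R_1,\dots,R_N)$ of the row index set $\mathcal{I}$ (parts may be empty) with $|R_j|=|C_j|$ for each $j$; (iii) $\mathrm{sgn}(R_1,\dots,R_N)\in\{\pm1\}$ is the sign of the permutation taking the concatenation $(R_1,R_2,\dots,R_N)$ (each $R_j$ listed in increasing order) to the natural order of $\mathcal{I}$. The total number of squared-modulus terms is $\binom{N\cdot2^{n-1}}{2^{n-1}}$, and the matrix $\mathsf{F}\mathsf{F}^*$ is positive semidefinite.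
   Context: $\mathbb{R}_n$ is the real unital associative algebra generated by $I_1,\dots,I_n$ with $I_iI_j+I_jI_i=-2\delta_{ij}$; $\mathcal{I}$ is the set of subsets of $\{2,\dots,n\}$, $|\mathcal{I}|=2^{n-1}$; for $A=\{a_1<\dots<a_k\}\in\mathcal{I}$, $I_A=I_{a_1}\cdots I_{a_k}$, $I_\emptyset=1$. Fix a unit 1-vector $I=I_1$ (so $I^2=-1$), $\mathbb{C}_I=\mathbb{R}+I\mathbb{R}\cong\mathbb{C}$, and identify $\mathbb{B}\cap\mathbb{C}_I$ with the unit disc $\mathbb{D}$. A real-differentiable $f:\mathbb{B}\to\mathbb{R}_n$ is slice monogenic if for every unit 1-vector $J$ its restriction $f_J$ to $\mathbb{B}\cap\mathbb{C}_J$ satisfies $\frac12(\partial_u+J\partial_v)f_J(u+Jv)=0$; then $f_I=\sum_{A\in\mathcal{I}}F_AI_A$ with holomorphic $F_A:\mathbb{D}\to\mathbb{C}_I\cong\mathbb{C}$. Write $f_{j}|_{\mathbb{C}_I}=\sum_AF_A^{(j)}I_A$. $\hat F(z)=\overline{F(\bar z)}$; $A\triangle B$ is the symmetric difference; $\sigma(A,B)=|A\cap B|+|\{(a,b)\in A\times B:a>b\}|$ for $A,B\in\mathcal{I}$. $M_f$ is the $2^{n-1}\times2^{n-1}$ matrix indexed by $\mathcal{I}\times\mathcal{I}$ with $(M_f)_{A,B}=(-1)^{\sigma(A\triangle B,B)}F_{A\triangle B}$ if $|A|$ is even, and $(-1)^{\sigma(A\triangle B,B)}\hat F_{A\triangle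 B}$ if $|A|$ is odd. For $R,C\subseteq\mathcal{I}$ with $|R|=|C|$, $m_R^C(f_j)=\det[(M_{f_j})_{A,B}]_{A\in R,B\in C}$ is the minor with rows $R$ and columns $C$ (listed in the fixed order; the empty minor is $1$). $\mathsf{F}^*$ is the conjugate transpose. $N$ is a positive integer. *)

theory Defs
  imports
    "HOL-Analysis.Analysis"
    "HOL-Combinatorics.Permutations"
    "Jordan_Normal_Form.Determinant"
    "Jordan_Normal_Form.Schur_Decomposition"
begin

section \<open>The Clifford algebra with \<open>n\<close> generators of square \<open>-1\<close>\<close>

text \<open>The generators are indexed by a finite linearly ordered type \<open>'n\<close> with \<open>n\<close> elements,
  which plays the role of \<open>{1 < \<dots> < n}\<close>.  An element is given by its coordinates with respect to
  the basis of products \<open>I\<^sub>A = I\<^bsub>a\<^sub>1\<^esub> \<cdots> I\<^bsub>a\<^sub>k\<^esub>\<close>, where \<open>A = {a\<^sub>1 < \<dots> < a\<^sub>k}\<close> ranges over all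
  subsets of the index type; multiplication is determined by
  \<open>I\<^sub>A I\<^sub>B = (-1)\<^bsup>\<sigma>(A,B)\<^esup> I\<^bsub>A \<triangle> B\<^esub>\<close>.\<close>

typedef 'n clifford = "UNIV :: ('n set \<Rightarrow> real) set"
  morphisms coord Clifford
  by simp

lemma coord_Clifford [simp]: "coord (Clifford g) = g"
  by (simp add: Clifford_inverse)

lemma clifford_eq_iff: "x = y \<longleftrightarrow> (\<forall>A. coord x A = coord y A)"
  by (metis coord_inject ext)

definition \<sigma> :: "'n::{finite,linorder} set \<Rightarrow> 'n set \<Rightarrow> nat" where
  "\<sigma> A B = card (A \<inter> B) + card {(a, b). (a, b) \<in> A \<times> B \<and> a > b}"

instantiation clifford :: (finite) real_vector
begin

definition "0 = Clifford (\<lambda>_. 0)"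
definition "x + y = Clifford (\<lambda>A. coord x A + coord y A)"
definition "- x = Clifford (\<lambda>A. - coord x A)"
definition "x - y = Clifford (\<lambda>A. coord x A - coord y A)"
definition "c *\<^sub>R x = Clifford (\<lambda>A. c * coord x A)"

instance
  by standard (simp_all add: clifford_eq_iff zero_clifford_def plus_clifford_def
      uminus_clifford_def minus_clifford_def scaleR_clifford_def algebra_simps)

end

lemma coord_simps [simp]:
  "coord 0 A = 0" "coord (x + y) A = coord x A + coord y A" "coord (- x) A = - coord x A"
  "coord (x - y) A = coord x A - coord y A" "coord (c *\<^sub>R x) A = c * coord x A"
  by (simp_all add: zero_clifford_def plus_clifford_def
      uminus_clifford_def minus_clifford_def scaleR_clifford_def)

lemma coord_sum [simp]: "coord (sum g X) A = (\<Sum>x\<in>X. coord (g x) A)"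
  by (induction X rule: infinite_finite_induct) auto

instantiation clifford :: (finite) real_inner
begin

definition "inner x y = (\<Sum>A\<in>UNIV. coord x A * coord y A)"
definition "norm (x :: 'a clifford) = sqrt (inner x x)"
definition "sgn (x :: 'a clifford) = x /\<^sub>R norm x"
definition "dist (x :: 'a clifford) y = norm (x - y)"
definition [code del]:
  "(uniformity :: ('a clifford \<times> 'a clifford) filter) = (INF e\<in>{0<..}. principal {(x, y). dist x y < e})"
definition [code del]:
  "open (U :: 'a clifford set) = (\<forall>x\<in>U. eventually (\<lambda>(x', y). x' = x \<longrightarrow> y \<in> U) uniformity)"

instance
proof
  fix x y z :: "'a clifford" and c :: real
  show "inner x y = inner y x" by (simp add: inner_clifford_def mult.commute)
  show "inner (x + y) z = inner x z + inner y z"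
    by (simp add: inner_clifford_def algebra_simps sum.distrib)
  show "inner (c *\<^sub>R x) y = c * inner x y"
    by (simp add: inner_clifford_def sum_distrib_left mult.assoc)
  show "0 \<le> inner x x" by (simp add: inner_clifford_def sum_nonneg)
  show "(inner x x = 0) = (x = 0)"
    by (simp add: inner_clifford_def sum_nonneg_eq_0_iff clifford_eq_iff)
qed (simp_all add: norm_clifford_def sgn_clifford_def dist_clifford_def
    uniformity_clifford_def open_clifford_def)

end

lemma minus_one_power_\<sigma>:
  "(- 1 :: real) ^ \<sigma> A B = (\<Prod>a\<in>A. \<Prod>b\<in>B. if b \<le> a then - 1 else 1)"
proof -
  let ?P = "{(a, b). (a, b) \<in> A \<times> B \<and> b \<le> a}"
  have "card (A \<inter> B) = card ((\<lambda>a. (a, a)) ` (A \<inter> B))"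
    by (rule card_image [symmetric]) (simp add: inj_on_def)
  then have "\<sigma> A B = card ((\<lambda>a. (a, a)) ` (A \<inter> B) \<union> {(a, b). (a, b) \<in> A \<times> B \<and> a > b})"
    unfolding \<sigma>_def by (subst card_Un_disjoint) auto
  also have "(\<lambda>a. (a, a)) ` (A \<inter> B) \<union> {(a, b). (a, b) \<in> A \<times> B \<and> a > b} = ?P"
    by auto
  finally have "(- 1 :: real) ^ \<sigma> A B = (\<Prod>p\<in>?P. - 1)" by simp
  also have "\<dots> = (\<Prod>p\<in>A \<times> B. if snd p \<le> fst p then - 1 else 1)"
    by (rule prod.mono_neutral_cong_left) auto
  also have "\<dots> = (\<Prod>a\<in>A. \<Prod>b\<in>B. if b \<le> a then - 1 else 1)"
    by (simp add: prod.cartesian_product case_prod_beta)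
  finally show ?thesis .
qed

lemma prod_sym_diff:
  fixes g :: "'a \<Rightarrow> real"
  assumes "finite A" "finite B" "\<And>x. g x * g x = 1"
  shows "prod g (sym_diff A B) = prod g A * prod g B"
proof -
  have A: "prod g A = prod g (A - B) * prod g (A \<inter> B)"
    using prod.Int_Diff [OF assms(1), of g B] by (simp only: mult.commute)
  have B: "prod g B = prod g (B - A) * prod g (A \<inter> B)"
    using prod.Int_Diff [OF assms(2), of g A] by (simp only: mult.commute Int_commute)
  have "prod g (A \<inter> B) * prod g (A \<inter> B) = 1"
    by (simp add: prod.distrib [symmetric] assms(3))
  moreover have "prod g (sym_diff A B) = prod g (A - B) * prod g (B - A)"
    using assms(1,2) by (intro prod.union_disjoint) auto
  ultimately show ?thesis unfolding A B by (simp add: algebra_simps)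
qed

lemma \<sigma>_sym_diff:
  "(- 1 :: real) ^ \<sigma> (sym_diff A B) C = (- 1) ^ \<sigma> A C * (- 1) ^ \<sigma> B C"
  "(- 1 :: real) ^ \<sigma> A (sym_diff B C) = (- 1) ^ \<sigma> A B * (- 1) ^ \<sigma> A C"
proof -
  let ?g = "\<lambda>a b. if b \<le> a then - 1 else 1 :: real"
  show "(- 1 :: real) ^ \<sigma> (sym_diff A B) C = (- 1) ^ \<sigma> A C * (- 1) ^ \<sigma> B C"
    unfolding minus_one_power_\<sigma>
    by (rule prod_sym_diff) (simp_all add: prod.distrib [symmetric])
  have "(\<Prod>b\<in>sym_diff B C. ?g a b) = (\<Prod>b\<in>B. ?g a b) * (\<Prod>b\<in>C. ?g a b)" for a
    by (rule prod_sym_diff) simp_all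
  then show "(- 1 :: real) ^ \<sigma> A (sym_diff B C) = (- 1) ^ \<sigma> A B * (- 1) ^ \<sigma> A C"
    unfolding minus_one_power_\<sigma> by (simp only: prod.distrib)
qed

lemma \<sigma>_empty [simp]: "\<sigma> {} A = 0" "\<sigma> A {} = 0"
  by (simp_all add: \<sigma>_def)

lemma \<sigma>_singleton_less:
  assumes "\<And>b. b \<in> B \<Longrightarrow> a < b"
  shows "\<sigma> {a} B = 0"
proof -
  have "{a} \<inter> B = {}" "{(a', b). (a', b) \<in> {a} \<times> B \<and> b < a'} = {}"
    using assms by force+
  then show ?thesis unfolding \<sigma>_def by (simp only: card.empty)
qed

lemma sym_diff_cancel: "sym_diff A (sym_diff A B) = B"
  by auto

lemma sym_diff_eq_iff: "sym_diff A B = C \<longleftrightarrow> B = sym_diff A C"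
  by (metis sym_diff_cancel)

lemma bij_sym_diff: "bij (sym_diff A)"
  by (rule involuntory_imp_bij) (rule sym_diff_cancel)

instantiation clifford :: ("{finite,linorder}") real_algebra_1
begin

definition one_clifford :: "'a clifford" where
  "one_clifford = Clifford (\<lambda>A. if A = {} then 1 else 0)"

text \<open>The coefficient of the product at \<open>I\<^sub>C\<close> collects all pairs \<open>(A, B)\<close> with \<open>A \<triangle> B = C\<close>,
  that is, \<open>B = A \<triangle> C\<close>.\<close>

definition times_clifford :: "'a clifford \<Rightarrow> 'a clifford \<Rightarrow> 'a clifford" where
  "times_clifford x y = Clifford (\<lambda>C. \<Sum>A\<in>UNIV.
     (- 1) ^ \<sigma> A (sym_diff A C) * coord x A * coord y (sym_diff A C))"

instance
proof
  fix x y z :: "'a clifford" and c :: real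
  show "x * y * z = x * (y * z)"
    unfolding clifford_eq_iff
  proof
    fix D
    let ?s = "\<lambda>A B. (- 1 :: real) ^ \<sigma> A (B :: 'a set)"
    have "coord (x * y * z) D = (\<Sum>A\<in>UNIV. \<Sum>E\<in>UNIV. ?s E (sym_diff E D) *
        (?s A (sym_diff A E) * coord x A * coord y (sym_diff A E)) * coord z (sym_diff E D))"
      by (subst sum.swap) (simp add: times_clifford_def sum_distrib_left sum_distrib_right)
    also have "\<dots> = (\<Sum>A\<in>UNIV. \<Sum>B\<in>UNIV. ?s (sym_diff A B) (sym_diff (sym_diff A B) D) *
        (?s A B * coord x A * coord y B) * coord z (sym_diff (sym_diff A B) D))"
      (is "sum ?f UNIV = sum ?g UNIV")
    proof (rule sum.cong [OF refl])
      fix A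
      show "?f A = ?g A"
        by (subst sum.reindex_bij_betw [OF bij_sym_diff [of A], symmetric])
          (simp only: sym_diff_cancel)
    qed
    also have "\<dots> = (\<Sum>A\<in>UNIV. \<Sum>B\<in>UNIV. ?s A (sym_diff A D) * coord x A *
        (?s B (sym_diff B (sym_diff A D)) * coord y B * coord z (sym_diff B (sym_diff A D))))"
    proof (intro sum.cong refl)
      fix A B :: "'a set"
      define C where "C = sym_diff (sym_diff A B) D"
      have C: "sym_diff B (sym_diff A D) = C" "sym_diff A D = sym_diff B C"
        by (auto simp: C_def)
      show "?s (sym_diff A B) (sym_diff (sym_diff A B) D) *
          (?s A B * coord x A * coord y B) * coord z (sym_diff (sym_diff A B) D) =
        ?s A (sym_diff A D) * coord x A *
          (?s B (sym_diff B (sym_diff A D)) * coord y B * coord z (sym_diff B (sym_diff A D)))"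
        unfolding C(1) unfolding C(2) unfolding C_def [symmetric] \<sigma>_sym_diff
        by (simp add: mult_ac)
    qed
    also have "\<dots> = coord (x * (y * z)) D"
      by (simp add: times_clifford_def sum_distrib_left)
    finally show "coord (x * y * z) D = coord (x * (y * z)) D" .
  qed
  show "1 * x = x"
    by (simp add: clifford_eq_iff times_clifford_def one_clifford_def if_distrib if_distribR
        cong: if_cong)
  show "x * 1 = x"
    unfolding clifford_eq_iff
  proof
    fix C :: "'a set"
    have "sym_diff A C = {} \<longleftrightarrow> A = C" for A :: "'a set" by auto
    then show "coord (x * 1) C = coord x C"
      by (simp add: times_clifford_def one_clifford_def if_distrib cong: if_cong)
  qed
  show "(x + y) * z = x * z + y * z" "x * (y + z) = x * y + x * z"
    by (simp_all add: clifford_eq_iff times_clifford_def algebra_simps sum.distrib)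
  show "c *\<^sub>R x * y = c *\<^sub>R (x * y)" "x * c *\<^sub>R y = c *\<^sub>R (x * y)"
    by (simp_all add: clifford_eq_iff times_clifford_def sum_distrib_left mult_ac)
  show "(0 :: 'a clifford) \<noteq> 1"
    by (auto simp: clifford_eq_iff one_clifford_def)
qed

end

definition gen :: "'n::{finite,linorder} \<Rightarrow> 'n clifford" where
  "gen i = Clifford (\<lambda>A. if A = {i} then 1 else 0)"

definition blade :: "'n::{finite,linorder} set \<Rightarrow> 'n clifford" where
  "blade A = prod_list (map gen (sorted_list_of_set A))"

lemma coord_one: "coord 1 A = (if A = {} then 1 else 0)"
  by (simp add: one_clifford_def)

lemma coord_gen: "coord (gen i) A = (if A = {i} then 1 else 0)"
  by (simp add: gen_def)

lemma coord_gen_mult: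
  "coord (gen i * x) C = (- 1) ^ \<sigma> {i} (sym_diff {i} C) * coord x (sym_diff {i} C)"
proof -
  have "coord (gen i * x) C = (\<Sum>A\<in>UNIV. if A = {i}
      then (- 1) ^ \<sigma> {i} (sym_diff {i} C) * coord x (sym_diff {i} C) else 0)"
    unfolding times_clifford_def coord_Clifford coord_gen
    by (rule sum.cong) simp_all
  then show ?thesis by simp
qed

text \<open>The defining relations of the algebra.\<close>

lemma gen_relations:
  "gen i * gen j + gen j * gen i = (if i = j then - 2 else 0)"
proof -
  have s: "\<sigma> {i} {j} = (if j \<le> i then 1 else 0)" for i j :: 'a
  proof -
    have "{(a, b). (a, b) \<in> {i} \<times> {j} \<and> b < a} = (if j < i then {(i, j)} else {})" by auto
    then show ?thesis by (auto simp: \<sigma>_def)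
  qed
  have c: "coord (gen i * gen j) C = (if C = sym_diff {i} {j} then (- 1) ^ \<sigma> {i} {j} else 0)"
    for i j :: 'a and C
  proof -
    have "sym_diff {i} C = {j} \<longleftrightarrow> C = sym_diff {i} {j}" by blast
    then show ?thesis unfolding coord_gen_mult coord_gen
      by (cases "C = sym_diff {i} {j}") simp_all
  qed
  have two: "coord 2 C = (if C = {} then 2 else 0)" for C :: "'a set"
  proof -
    have "coord (1 + 1) C = (if C = {} then 2 else 0)"
      by (simp only: coord_simps coord_one) simp
    then show ?thesis by simp
  qed
  show ?thesis
  proof (cases "i = j")
    case True
    then show ?thesis by (simp add: clifford_eq_iff c s two)
  next
    case False
    have "sym_diff {j} {i} = sym_diff {i} {j}" by (rule Un_commute)
    then have "coord (gen i * gen j + gen j * gen i) C = 0" for C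
      using False unfolding coord_simps c s by (cases i j rule: linorder_cases) auto
    with False show ?thesis by (simp add: clifford_eq_iff)
  qed
qed

lemma coord_blade: "coord (blade A) B = (if B = A then 1 else 0)"
proof -
  have "coord (prod_list (map gen xs)) B = (if B = set xs then 1 else 0)"
    if "sorted xs" "distinct xs" for xs :: "'a list" and B
    using that
  proof (induction xs arbitrary: B)
    case (Cons x xs)
    have lt: "x < y" if "y \<in> set xs" for y
      using that Cons.prems by (metis distinct.simps(2) order_neq_le_trans sorted_simps(2))
    have "\<sigma> {x} (set xs) = 0" by (rule \<sigma>_singleton_less) (rule lt)
    have "x \<notin> set xs" using Cons.prems by simp
    then have "sym_diff {x} (set xs) = set (x # xs)" by auto
    with sym_diff_eq_iff [of "{x}" B "set xs"] have iff: "sym_diff {x} B = set xs \<longleftrightarrow> B = set (x # xs)"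
      by (simp only:)
    have "coord (prod_list (map gen xs)) B' = (if B' = set xs then 1 else 0)" for B'
      using Cons.prems by (intro Cons.IH) simp_all
    then have "coord (prod_list (map gen (x # xs))) B =
        (- 1) ^ \<sigma> {x} (sym_diff {x} B) * (if sym_diff {x} B = set xs then 1 else 0)"
      unfolding list.map prod_list.Cons coord_gen_mult by (simp only:)
    also have "(- 1) ^ \<sigma> {x} D * (if D = set xs then 1 else 0) = (if D = set xs then 1 else 0 :: real)"
      for D
      using \<open>\<sigma> {x} (set xs) = 0\<close> by (cases "D = set xs") simp_all
    finally show ?case unfolding iff .
  qed (simp add: coord_one)
  from this [of "sorted_list_of_set A" B] show ?thesis by (simp add: blade_def)
qed

lemma clifford_expansion: "x = (\<Sum>A\<in>UNIV. coord x A *\<^sub>R blade A)"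
proof -
  have "(\<Sum>A\<in>UNIV. coord x A * coord (blade A) B) = (\<Sum>A\<in>UNIV. if B = A then coord x A else 0)" for B
    by (rule sum.cong) (simp_all add: coord_blade)
  then show ?thesis by (simp add: clifford_eq_iff)
qed

section \<open>Slice monogenic functions on the unit ball\<close>

text \<open>The point \<open>x\<^sub>0 + x\<^sub>1 I\<^sub>1 + \<dots> + x\<^sub>n I\<^sub>n\<close> of \<open>\<real>\<^sup>n\<^sup>+\<^sup>1\<close> is represented by the pair \<open>(x\<^sub>0, x)\<close>; with
  the product norm, \<open>ball 0 1\<close> is the Euclidean unit ball.  For
  \<open>J = vector1 w\<close> with \<open>norm w = 1\<close>, the point \<open>u + J v\<close> is \<open>(u, v *\<^sub>R w)\<close>.\<close>

type_synonym 'n paravector = "real \<times> (real, 'n) Finite_Cartesian_Product.vec"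

definition vector1 :: "real ^ ('n::{finite,linorder}) \<Rightarrow> 'n clifford" where
  "vector1 w = (\<Sum>i\<in>UNIV. vec_nth w i *\<^sub>R gen i)"

definition slice_monogenic :: "('n paravector \<Rightarrow> 'n::{finite,linorder} clifford) \<Rightarrow> bool" where
  "slice_monogenic f \<longleftrightarrow>
     (\<forall>x\<in>ball 0 1. f differentiable (at x)) \<and>
     (\<forall>w. norm w = 1 \<longrightarrow> (\<forall>u v. (u, v *\<^sub>R w) \<in> ball 0 1 \<longrightarrow>
        (1 / 2) *\<^sub>R (vector_derivative (\<lambda>t. f (t, v *\<^sub>R w)) (at u)
          + vector1 w * vector_derivative (\<lambda>t. f (u, t *\<^sub>R w)) (at v)) = 0))"

section \<open>Components with respect to the slice \<open>\<complex>\<^sub>I\<close>, \<open>I = I\<^sub>1\<close>\<close>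

definition idx1 :: "'n::{finite,linorder}" where
  "idx1 = Min UNIV"

text \<open>The subsets of \<open>{2, \<dots>, n}\<close>.\<close>

definition multi_indices :: "'n::{finite,linorder} set set" where
  "multi_indices = Pow (UNIV - {idx1})"

definition of_complex :: "complex \<Rightarrow> 'n::{finite,linorder} clifford" where
  "of_complex z = of_real (Re z) + Im z *\<^sub>R gen idx1"

definition slice :: "('n paravector \<Rightarrow> 'n::{finite,linorder} clifford) \<Rightarrow> complex \<Rightarrow> 'n clifford" where
  "slice f z = f (Re z, Im z *\<^sub>R axis idx1 1)"

text \<open>\<open>component f A\<close> is the function \<open>F\<^sub>A\<close>: since \<open>(x + I y) I\<^sub>A = x I\<^sub>A + y I\<^bsub>A \<union> {1}\<^esub>\<close>, it is read off
  from two coordinates of \<open>f\<^sub>I\<close>.  The lemma \<open>slice_decomposition\<close> below shows that these are the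
  unique functions with \<open>f\<^sub>I = \<Sum>\<^sub>A F\<^sub>A I\<^sub>A\<close>.\<close>

definition component ::
    "('n paravector \<Rightarrow> 'n::{finite,linorder} clifford) \<Rightarrow> 'n set \<Rightarrow> complex \<Rightarrow> complex" where
  "component f A z = Complex (coord (slice f z) A) (coord (slice f z) (insert idx1 A))"

lemma card_multi_indices:
  "card (multi_indices :: 'n::{finite,linorder} set set) = 2 ^ (CARD('n) - 1)"
  by (simp add: multi_indices_def card_Pow card_Diff_singleton)

lemma coord_of_complex_blade:
  fixes A :: "'n::{finite,linorder} set"
  assumes "A \<in> multi_indices"
  shows "coord (of_complex c * blade A) B =
    (if B = A then Re c else if B = insert idx1 A then Im c else 0)"
proof -
  have A: "idx1 \<notin> A" using assms by (auto simp: multi_indices_def)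
  then have lt: "a \<in> A \<Longrightarrow> idx1 < a" for a
    by (metis Min_le UNIV_I finite idx1_def less_le)
  then have s: "\<sigma> {idx1} A = 0" by (rule \<sigma>_singleton_less)
  have "sym_diff {idx1} B = A \<longleftrightarrow> B = insert idx1 A" using A by auto
  then show ?thesis using A s
    by (auto simp: of_complex_def of_real_def distrib_right coord_gen_mult coord_blade)
qed

lemma slice_decomposition:
  fixes f :: "'n paravector \<Rightarrow> 'n::{finite,linorder} clifford"
  shows "slice f z = (\<Sum>A\<in>multi_indices. of_complex (G A) * blade A) \<longleftrightarrow>
    (\<forall>A\<in>multi_indices. G A = component f A z)"
proof -
  have c: "coord (\<Sum>A\<in>multi_indices. of_complex (G A) * blade A) B =
      (if idx1 \<in> B then Im (G (B - {idx1})) else Re (G B))" for B :: "'n set"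
  proof -
    let ?B = "B - {idx1}"
    have "coord (\<Sum>A\<in>multi_indices. of_complex (G A) * blade A) B =
       (\<Sum>A\<in>multi_indices. if A = ?B then (if idx1 \<in> B then Im (G ?B) else Re (G ?B)) else 0)"
      unfolding coord_sum
      by (intro sum.cong refl, subst coord_of_complex_blade) (auto simp: multi_indices_def)
    also have "\<dots> = (if idx1 \<in> B then Im (G ?B) else Re (G ?B))"
      by (auto simp: multi_indices_def)
    finally show ?thesis by auto
  qed
  show ?thesis
  proof
    assume L: "slice f z = (\<Sum>A\<in>multi_indices. of_complex (G A) * blade A)"
    show "\<forall>A\<in>multi_indices. G A = component f A z"
      unfolding component_def L c by (auto simp: multi_indices_def complex_eq_iff)
  next
    assume R: "\<forall>A\<in>multi_indices. G A = component f A z"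
    show "slice f z = (\<Sum>A\<in>multi_indices. of_complex (G A) * blade A)"
      unfolding clifford_eq_iff c
    proof
      fix B :: "'n set"
      have "G (B - {idx1}) = component f (B - {idx1}) z"
        using R by (auto simp: multi_indices_def)
      then show "coord (slice f z) B = (if idx1 \<in> B then Im (G (B - {idx1})) else Re (G B))"
        by (auto simp: component_def insert_absorb)
    qed
  qed
qed

section \<open>The matrices and minors\<close>

definition hat :: "(complex \<Rightarrow> complex) \<Rightarrow> complex \<Rightarrow> complex" where
  "hat F z = cnj (F (cnj z))"

definition matrix_entry :: "('n paravector \<Rightarrow> 'n::{finite,linorder} clifford) \<Rightarrow> complex \<Rightarrow>
    'n set \<Rightarrow> 'n set \<Rightarrow> complex" where
  "matrix_entry f z A B = (- 1) ^ \<sigma> (sym_diff A B) B *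
     (if even (card A) then component f (sym_diff A B) z else hat (component f (sym_diff A B)) z)"

text \<open>The elements of a finite set in increasing order with respect to the order relation \<open>r\<close>.\<close>

definition listing :: "'a rel \<Rightarrow> 'a set \<Rightarrow> 'a list" where
  "listing r X = (THE xs. distinct xs \<and> set xs = X \<and> sorted_wrt (\<lambda>a b. (a, b) \<in> r) xs)"

definition minor :: "'n set rel \<Rightarrow> ('n paravector \<Rightarrow> 'n::{finite,linorder} clifford) \<Rightarrow>
    complex \<Rightarrow> 'n set set \<Rightarrow> 'n set set \<Rightarrow> complex" where
  "minor r f z R C = Determinant.det (Matrix.mat (card R) (card C)
     (\<lambda>(i, j). matrix_entry f z (listing r R ! i) (listing r C ! j)))"

text \<open>The \<open>f\<^sub>j\<close>, and the blocks of \<open>\<F>\<close>, are numbered by \<open>j < N\<close>, and its rows and columns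
  from \<open>0\<close>: column \<open>k\<close> of \<open>\<F>\<close> is column \<open>k mod 2\<^bsup>n-1\<^esup>\<close> of block \<open>k div 2\<^bsup>n-1\<^esup>\<close>.\<close>

definition block_matrix :: "'n set rel \<Rightarrow> nat \<Rightarrow>
    (nat \<Rightarrow> 'n paravector \<Rightarrow> 'n::{finite,linorder} clifford) \<Rightarrow> complex \<Rightarrow> complex mat" where
  "block_matrix r N f z = (let m = 2 ^ (CARD('n) - 1) in
     Matrix.mat m (N * m)
       (\<lambda>(i, k). matrix_entry (f (k div m)) z
         (listing r multi_indices ! i) (listing r multi_indices ! (k mod m))))"

text \<open>\<open>block_columns r S j\<close> is the set \<open>C\<^sub>j\<close> of those \<open>B\<close> for which column \<open>B\<close> of block \<open>j\<close> is in \<open>S\<close>.\<close>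

definition block_columns :: "'n::{finite,linorder} set rel \<Rightarrow> nat set \<Rightarrow> nat \<Rightarrow> 'n set set" where
  "block_columns r S j =
     {listing r multi_indices ! k | k. k < 2 ^ (CARD('n) - 1) \<and> j * 2 ^ (CARD('n) - 1) + k \<in> S}"

definition ordered_partitions :: "nat \<Rightarrow> 'a set \<Rightarrow> (nat \<Rightarrow> nat) \<Rightarrow> (nat \<Rightarrow> 'a set) set" where
  "ordered_partitions N X c =
     {R \<in> {..<N} \<rightarrow>\<^sub>E Pow X. (\<Union>j<N. R j) = X \<and> disjoint_family_on R {..<N} \<and> (\<forall>j<N. card (R j) = c j)}"

text \<open>Here \<open>permute_list p xs = map (\<lambda>i. xs ! p i) [0..<length xs]\<close>; the permutation acts on the
  positions of the concatenated list.\<close>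

definition partition_sign :: "'a rel \<Rightarrow> nat \<Rightarrow> (nat \<Rightarrow> 'a set) \<Rightarrow> int" where
  "partition_sign r N R = (let xs = concat (map (\<lambda>j. listing r (R j)) [0..<N]) in
     sign (THE p. p permutes {..<length xs} \<and> permute_list p xs = listing r (\<Union>j<N. R j)))"

definition H_infinity :: "(complex \<Rightarrow> complex) set" where
  "H_infinity = {g. g holomorphic_on ball 0 1 \<and> bounded (g ` ball 0 1)}"

text \<open>In the order on \<^typ>\<open>complex\<close>, \<open>0 \<le> w\<close> means that \<open>w\<close> is real and nonnegative;
  \<open>(A *\<^sub>v v) \<bullet>c v\<close> is \<open>v\<^sup>* A v\<close>.\<close>

definition positive_semidefinite :: "complex mat \<Rightarrow> bool" where
  "positive_semidefinite A \<longleftrightarrow> square_mat A \<and> mat_adjoint A = A \<and>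
     (\<forall>v\<in>carrier_vec (dim_row A). 0 \<le> (A *\<^sub>v v) \<bullet>c v)"

end

theory Submission
  imports Defs
begin

text \<open>The determinant identity is the Cauchy-Binet formula for \<open>\<F>\<close> and \<open>\<F>\<^sup>*\<close>, followed by a Laplace
  expansion of each maximal minor along its column blocks.  For the latter, multilinearity in the
  rows writes the determinant as a sum over the ways of assigning each row to a block.  An
  assignment contributes \<open>0\<close> unless every block receives as many rows as it has columns; otherwise
  sorting the rows by block makes the matrix block diagonal, at the price of the sign of the
  partition.\<close>

text \<open>Only the rows contribute a sign, because the columns need no sorting. Column
  \<open>k\<close> has block \<open>k div m\<close> and position \<open>k mod m\<close>, where
  \<open>m = 2 ^ (CARD('n) - 1)\<close>, so the increasing order of \<open>S\<close> already runs
  through the sets \<open>C_j\<close> one after the other, each of them in increasing order for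
  \<open>r\<close>. An assignment with wrong block sizes contributes nothing because a nonzero
  Leibniz term would match every row with a column of the block assigned to it. Matrices are
  labelled by lists of rows and columns: sorting the rows is then a permutation of a list, a block
  decomposition is a concatenation, and a column label that contains its block number tells which
  entries survive an assignment. These identities are algebra at a fixed \<open>z\<close>. The
  analysis lies in the membership of the entries in \<open>H_infinity\<close>: left multiplication
  by \<open>gen idx1\<close> pairs the coordinates at \<open>A\<close> and
  \<open>insert idx1 A\<close> like real and imaginary part.\<close>

unbundle no vec_syntax

section \<open>The Cauchy-Binet formula and Gram matrices\<close>

lemma permutes_less:
  fixes p :: "nat \<Rightarrow> nat"
  assumes "p permutes {0..<m}" "i < m"
  shows "p i < m"
  using permutes_in_image [OF assms(1), of i] assms(2) by simp

abbreviation select_cols :: "'a mat \<Rightarrow> nat set \<Rightarrow> 'a mat" where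
  "select_cols A S \<equiv> Matrix.mat (dim_row A) (card S) (\<lambda>(i, j). A $$ (i, sorted_list_of_set S ! j))"

abbreviation select_rows :: "'a mat \<Rightarrow> nat set \<Rightarrow> 'a mat" where
  "select_rows A S \<equiv> Matrix.mat (card S) (dim_col A) (\<lambda>(i, j). A $$ (sorted_list_of_set S ! i, j))"

text \<open>In Cauchy-Binet this turns the choices of columns with image \<open>S\<close> into
  permutations of the row positions, relative to a fixed enumeration \<open>e\<close> of
  \<open>S\<close>. The restriction reconciles two conventions outside \<open>T\<close>:
  permutations are the identity there, members of the function space are
  \<open>undefined\<close>.\<close>

lemma bij_betw_permutes_PiE:
  assumes "bij_betw e T S"
  shows "bij_betw (\<lambda>q. restrict (e \<circ> q) T) {q. q permutes T} {g \<in> T \<rightarrow>\<^sub>E S. bij_betw g T S}"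
proof (rule bij_betwI')
  fix p q assume "p \<in> {q. q permutes T}" "q \<in> {q. q permutes T}"
  then have p: "p permutes T" and q: "q permutes T" by simp_all
  show "restrict (e \<circ> p) T = restrict (e \<circ> q) T \<longleftrightarrow> p = q"
  proof
    assume eq: "restrict (e \<circ> p) T = restrict (e \<circ> q) T"
    show "p = q"
    proof
      fix x
      show "p x = q x"
      proof (cases "x \<in> T")
        case True
        then have "e (p x) = e (q x)" using fun_cong [OF eq, of x] by simp
        with True assms p q show ?thesis
          by (meson bij_betw_imp_inj_on inj_onD permutes_in_image)
      next
        case False
        then show ?thesis using p q by (simp add: permutes_not_in)
      qed
    qed
  qed simp
next
  fix q assume "q \<in> {q. q permutes T}"
  then have "bij_betw (e \<circ> q) T S"
    using assms by (auto intro: bij_betw_trans permutes_imp_bij)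
  then have "bij_betw (restrict (e \<circ> q) T) T S"
    by (subst bij_betw_cong [of _ _ "e \<circ> q"]) simp_all
  then show "restrict (e \<circ> q) T \<in> {g \<in> T \<rightarrow>\<^sub>E S. bij_betw g T S}"
    by (auto simp: bij_betw_def)
next
  fix g assume "g \<in> {g \<in> T \<rightarrow>\<^sub>E S. bij_betw g T S}"
  then have g: "g \<in> T \<rightarrow>\<^sub>E S" "bij_betw g T S" by simp_all
  \<comment> \<open>The preimage of \<open>g\<close> is \<open>g\<close> pulled back along
    \<open>e\<close>, extended by the identity as \<open>permutes\<close> demands.\<close>
  define q where "q = (\<lambda>x. if x \<in> T then inv_into T e (g x) else x)"
  have "bij_betw (inv_into T e \<circ> g) T T"
    using g(2) bij_betw_inv_into [OF assms] by (rule bij_betw_trans)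
  then have "bij_betw q T T"
    by (subst bij_betw_cong [of _ _ "inv_into T e \<circ> g"]) (simp_all add: q_def)
  then have "q permutes T"
    by (rule bij_imp_permutes) (simp add: q_def)
  moreover have "g = restrict (e \<circ> q) T"
  proof
    fix x show "g x = restrict (e \<circ> q) T x"
    proof (cases "x \<in> T")
      case True
      then have "g x \<in> e ` T" using g(1) assms by (auto simp: bij_betw_def)
      then have "e (q x) = g x" using True unfolding q_def by (simp only: if_True f_inv_into_f)
      with True show ?thesis by simp
    next
      case False
      then show ?thesis using g(1) by (simp add: PiE_iff extensional_def)
    qed
  qed
  ultimately show "\<exists>q \<in> {q. q permutes T}. g = restrict (e \<circ> q) T" by blast
qed

text \<open>Distributing the products of sums in the Leibniz formula yields one term for each choice
  \<open>g\<close> of an inner index per row, with the determinant of the rows \<open>g i\<close> of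
  \<open>B\<close> as a factor. A repeated index gives two equal rows, hence zero. The injective
  \<open>g\<close> are grouped by their image \<open>S\<close>; within a group they differ by a
  permutation.\<close>

theorem Cauchy_Binet:
  fixes A B :: "'a :: comm_ring_1 mat"
  assumes A: "A \<in> carrier_mat m K" and B: "B \<in> carrier_mat K m"
  shows "Determinant.det (A * B) = (\<Sum>S | S \<subseteq> {..<K} \<and> card S = m.
    Determinant.det (select_cols A S) * Determinant.det (select_rows B S))"
proof -
  let ?T = "{0..<m}"
  let ?G = "?T \<rightarrow>\<^sub>E {..<K}"
  let ?D = "\<lambda>g. Determinant.det (Matrix.mat m m (\<lambda>(i, j). B $$ (g i, j)))"
  let ?F = "\<lambda>g. (\<Prod>i\<in>?T. A $$ (i, g i)) * ?D g"
  have finG: "finite ?G" by (intro finite_PiE) auto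
  have "Determinant.det (A * B) =
      (\<Sum>p | p permutes ?T. signof p * (\<Prod>i\<in>?T. (A * B) $$ (i, p i)))"
    by (rule det_def') (use A B in auto)
  also have "\<dots> = (\<Sum>p | p permutes ?T. \<Sum>g\<in>?G.
      (\<Prod>i\<in>?T. A $$ (i, g i)) * (signof p * (\<Prod>i\<in>?T. B $$ (g i, p i))))"
  proof (rule sum.cong [OF refl])
    fix p assume "p \<in> {p. p permutes ?T}"
    then have p: "i < m \<Longrightarrow> p i < m" for i
      using permutes_in_image [of p ?T i] by simp
    have "(\<Prod>i\<in>?T. (A * B) $$ (i, p i)) = (\<Prod>i\<in>?T. \<Sum>k<K. A $$ (i, k) * B $$ (k, p i))"
      using A B p by (intro prod.cong refl) (simp add: scalar_prod_def atLeast0LessThan)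
    also have "\<dots> = (\<Sum>g\<in>?G. \<Prod>i\<in>?T. A $$ (i, g i) * B $$ (g i, p i))"
      by (rule prod_sum_PiE) auto
    finally show "signof p * (\<Prod>i\<in>?T. (A * B) $$ (i, p i)) =
        (\<Sum>g\<in>?G. (\<Prod>i\<in>?T. A $$ (i, g i)) * (signof p * (\<Prod>i\<in>?T. B $$ (g i, p i))))"
      by (simp add: sum_distrib_left prod.distrib mult_ac)
  qed
  also have "\<dots> = (\<Sum>g\<in>?G. \<Sum>p | p permutes ?T.
      (\<Prod>i\<in>?T. A $$ (i, g i)) * (signof p * (\<Prod>i\<in>?T. B $$ (g i, p i))))"
    by (rule sum.swap)
  also have "\<dots> = (\<Sum>g\<in>?G. ?F g)"
  proof (rule sum.cong [OF refl])
    fix g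
    have "?D g = (\<Sum>p | p permutes ?T. signof p * (\<Prod>i\<in>?T. B $$ (g i, p i)))"
      by (subst det_def' [of _ m]) (auto intro!: sum.cong prod.cong simp: permutes_less)
    then show "(\<Sum>p | p permutes ?T.
        (\<Prod>i\<in>?T. A $$ (i, g i)) * (signof p * (\<Prod>i\<in>?T. B $$ (g i, p i)))) = ?F g"
      by (simp add: sum_distrib_left)
  qed
  also have "\<dots> = (\<Sum>g | g \<in> ?G \<and> inj_on g ?T. ?F g)"
  proof (rule sum.mono_neutral_right [OF finG])
    show "\<forall>g \<in> ?G - {g. g \<in> ?G \<and> inj_on g ?T}. ?F g = 0"
    proof
      fix g assume "g \<in> ?G - {g. g \<in> ?G \<and> inj_on g ?T}"
      then obtain i j where "i < m" "j < m" "i \<noteq> j" "g i = g j"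
        by (auto simp: inj_on_def)
      then have "?D g = 0"
        by (intro det_identical_rows [of _ m i j]) (auto intro!: eq_vecI)
      then show "?F g = 0" by simp
    qed
  qed auto
  also have "\<dots> = (\<Sum>S | S \<subseteq> {..<K} \<and> card S = m.
      \<Sum>g | g \<in> {g. g \<in> ?G \<and> inj_on g ?T} \<and> g ` ?T = S. ?F g)"
  proof (rule sum.group [symmetric])
    show "finite {g. g \<in> ?G \<and> inj_on g ?T}" using finG by simp
    show "finite {S. S \<subseteq> {..<K} \<and> card S = m}" by simp
    show "(\<lambda>g. g ` ?T) ` {g. g \<in> ?G \<and> inj_on g ?T} \<subseteq> {S. S \<subseteq> {..<K} \<and> card S = m}"
      by (auto simp: card_image)
  qed
  also have "\<dots> = (\<Sum>S | S \<subseteq> {..<K} \<and> card S = m.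
    Determinant.det (select_cols A S) * Determinant.det (select_rows B S))"
  proof (rule sum.cong [OF refl])
    fix S assume "S \<in> {S. S \<subseteq> {..<K} \<and> card S = m}"
    then have S: "S \<subseteq> {..<K}" "card S = m" by simp_all
    then have fS: "finite S" by (auto intro: finite_subset)
    let ?e = "(!) (sorted_list_of_set S)"
    have e: "bij_betw ?e ?T S"
      using fS S by (intro bij_betw_nth) auto
    have bij: "bij_betw (\<lambda>q. restrict (?e \<circ> q) ?T) {q. q permutes ?T}
        {g. g \<in> {g. g \<in> ?G \<and> inj_on g ?T} \<and> g ` ?T = S}"
    proof -
      have "{g \<in> ?T \<rightarrow>\<^sub>E S. bij_betw g ?T S} = {g. g \<in> {g. g \<in> ?G \<and> inj_on g ?T} \<and> g ` ?T = S}"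
        using S by (auto simp: bij_betw_def PiE_def Pi_def)
      with bij_betw_permutes_PiE [OF e] show ?thesis by (simp only:)
    qed
    have "(\<Sum>g | g \<in> {g. g \<in> ?G \<and> inj_on g ?T} \<and> g ` ?T = S. ?F g) =
        (\<Sum>q | q permutes ?T. ?F (restrict (?e \<circ> q) ?T))"
      by (rule sum.reindex_bij_betw [OF bij, symmetric])
    also have "\<dots> = (\<Sum>q | q permutes ?T. (signof q * (\<Prod>i\<in>?T. A $$ (i, ?e (q i)))) *
        Determinant.det (select_rows B S))"
    proof (rule sum.cong [OF refl])
      fix q assume "q \<in> {q. q permutes ?T}"
      then have q: "q permutes ?T" by simp
      \<comment> \<open>The rows of \<open>B\<close> chosen by \<open>g\<close> are those of
        \<open>select_rows B S\<close> permuted by \<open>q\<close>. The resulting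
        \<open>signof q\<close>, joined to the entries of \<open>A\<close>, is what the Leibniz
        formula for \<open>select_cols A S\<close> requires.\<close>
      have "Matrix.mat m m (\<lambda>(i, j). B $$ (restrict (?e \<circ> q) ?T i, j)) =
          Matrix.mat m m (\<lambda>(i, j). select_rows B S $$ (q i, j))"
        using S B q by (auto simp: permutes_less intro!: eq_matI)
      then have "?D (restrict (?e \<circ> q) ?T) = signof q * Determinant.det (select_rows B S)"
        using S B q by (simp only:) (intro det_permute_rows, auto)
      then show "?F (restrict (?e \<circ> q) ?T) = (signof q * (\<Prod>i\<in>?T. A $$ (i, ?e (q i)))) *
        Determinant.det (select_rows B S)" by simp
    qed
    also have "\<dots> = Determinant.det (select_cols A S) * Determinant.det (select_rows B S)"
    proof -
      have "Determinant.det (select_cols A S) =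
          (\<Sum>q | q permutes ?T. signof q * (\<Prod>i\<in>?T. A $$ (i, ?e (q i))))"
        using S A by (subst det_def' [of _ m]) (auto intro!: sum.cong prod.cong simp: permutes_less)
      then show ?thesis by (simp only: sum_distrib_right)
    qed
    finally show "(\<Sum>g | g \<in> {g. g \<in> ?G \<and> inj_on g ?T} \<and> g ` ?T = S. ?F g) =
      Determinant.det (select_cols A S) * Determinant.det (select_rows B S)" .
  qed
  finally show ?thesis .
qed

section \<open>Conjugate transposes and Gram matrices\<close>

lemma mat_adjoint_carrier:
  "A \<in> carrier_mat m K \<Longrightarrow> mat_adjoint A \<in> carrier_mat K m"
  unfolding mat_adjoint_def by auto

lemma index_mat_adjoint:
  "A \<in> carrier_mat m K \<Longrightarrow> i < K \<Longrightarrow> j < m \<Longrightarrow> mat_adjoint A $$ (i, j) = conjugate (A $$ (j, i))"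
  unfolding mat_adjoint_def by (auto simp: mat_of_rows_index)

text \<open>Selecting rows of the adjoint gives the conjugate transpose of the selected columns, so
  each Cauchy-Binet term is a number times its own conjugate.\<close>

lemma det_mult_adjoint:
  fixes A :: "complex mat"
  assumes A: "A \<in> carrier_mat m K"
  shows "Determinant.det (A * mat_adjoint A) = complex_of_real (\<Sum>S | S \<subseteq> {..<K} \<and> card S = m.
    (cmod (Determinant.det (select_cols A S)))\<^sup>2)"
proof -
  have *: "Determinant.det (select_rows (mat_adjoint A) S) = cnj (Determinant.det (select_cols A S))"
    if S: "S \<subseteq> {..<K}" "card S = m" for S
  proof -
    have fS: "finite S" using S by (auto intro: finite_subset)
    have nth: "sorted_list_of_set S ! i < K" if "i < m" for i
      using nth_mem [of i "sorted_list_of_set S"] that S fS by auto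
    have "select_rows (mat_adjoint A) S = map_mat cnj (transpose_mat (select_cols A S))"
      using A S nth mat_adjoint_carrier [OF A]
      by (auto intro!: eq_matI simp: index_mat_adjoint [OF A])
    then have "Determinant.det (select_rows (mat_adjoint A) S) =
        Determinant.det (map_mat cnj (transpose_mat (select_cols A S)))" by (simp only:)
    also have "\<dots> = cnj (Determinant.det (transpose_mat (select_cols A S)))"
      unfolding Determinant.det_def by (auto simp: permutes_less)
    also have "\<dots> = cnj (Determinant.det (select_cols A S))"
      using A S by (subst Determinant.det_transpose [of _ m]) auto
    finally show ?thesis .
  qed
  have "Determinant.det (A * mat_adjoint A) = (\<Sum>S | S \<subseteq> {..<K} \<and> card S = m.
    Determinant.det (select_cols A S) * Determinant.det (select_rows (mat_adjoint A) S))"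
    by (rule Cauchy_Binet [OF A mat_adjoint_carrier [OF A]])
  also have "\<dots> = (\<Sum>S | S \<subseteq> {..<K} \<and> card S = m.
    complex_of_real ((cmod (Determinant.det (select_cols A S)))\<^sup>2))"
  proof (rule sum.cong [OF refl])
    fix S assume "S \<in> {S. S \<subseteq> {..<K} \<and> card S = m}"
    then show "Determinant.det (select_cols A S) * Determinant.det (select_rows (mat_adjoint A) S) =
        complex_of_real ((cmod (Determinant.det (select_cols A S)))\<^sup>2)"
      by (subst *) (simp_all only: mem_Collect_eq complex_norm_square)
  qed
  finally show ?thesis by simp
qed

lemma positive_semidefinite_mult_adjoint:
  assumes A: "A \<in> carrier_mat m K"
  shows "positive_semidefinite (A * mat_adjoint A)"
proof -
  note A' = mat_adjoint_carrier [OF A]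
  have "mat_adjoint (A * mat_adjoint A) = A * mat_adjoint A"
  proof (rule eq_matI)
    have AA: "A * mat_adjoint A \<in> carrier_mat m m" using A A' by auto
    fix i j assume "i < dim_row (A * mat_adjoint A)" "j < dim_col (A * mat_adjoint A)"
    with A A' have ij: "i < m" "j < m" by auto
    have "(A * mat_adjoint A) $$ (i, j) = (\<Sum>k<K. A $$ (i, k) * cnj (A $$ (j, k)))"
      if "i < m" "j < m" for i j
      using A A' that by (simp add: scalar_prod_def atLeast0LessThan index_mat_adjoint [OF A])
    then show "mat_adjoint (A * mat_adjoint A) $$ (i, j) = (A * mat_adjoint A) $$ (i, j)"
      using ij by (simp add: index_mat_adjoint [OF AA] mult.commute)
  qed (use A A' in \<open>auto simp: mat_adjoint_def\<close>)
  moreover have "0 \<le> ((A * mat_adjoint A) *\<^sub>v v) \<bullet>c v" if v: "v \<in> carrier_vec m" for v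
  proof -
    \<comment> \<open>The quadratic form at \<open>v\<close> is the squared norm of this vector; the
      sums below move \<open>A\<close> across the inner product.\<close>
    define w where "w = mat_adjoint A *\<^sub>v v"
    have w: "w \<in> carrier_vec K" using A' v by (auto simp: w_def)
    have "conjugate w $ k = (\<Sum>i<m. A $$ (i, k) * cnj (v $ i))" if "k < K" for k
      using A A' v w that
      by (simp add: w_def scalar_prod_def atLeast0LessThan index_mat_adjoint [OF A])
    then have "w \<bullet>c w = (\<Sum>k<K. w $ k * (\<Sum>i<m. A $$ (i, k) * cnj (v $ i)))"
      using w carrier_vecD [OF w] unfolding scalar_prod_def
      by (simp add: atLeast0LessThan del: vec_index_conjugate)
    also have "\<dots> = (\<Sum>k<K. \<Sum>i<m. A $$ (i, k) * w $ k * cnj (v $ i))"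
      by (simp only: sum_distrib_left mult_ac)
    also have "\<dots> = (\<Sum>i<m. \<Sum>k<K. A $$ (i, k) * w $ k * cnj (v $ i))"
      by (rule sum.swap)
    also have "\<dots> = (\<Sum>i<m. (\<Sum>k<K. A $$ (i, k) * w $ k) * cnj (v $ i))"
      by (simp only: sum_distrib_right)
    also have "\<dots> = (A *\<^sub>v w) \<bullet>c v"
      using A v w by (simp add: scalar_prod_def atLeast0LessThan)
    also have "\<dots> = ((A * mat_adjoint A) *\<^sub>v v) \<bullet>c v"
      using A A' v by (simp add: assoc_mult_mat_vec w_def)
    finally show ?thesis using conjugate_square_ge_0_vec [of w] by simp
  qed
  ultimately show ?thesis
    using A A' unfolding positive_semidefinite_def by auto
qed

section \<open>Increasing listings\<close>

text \<open>If the heads differed, each would occur in the tail of the other list, so they would be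
  related both ways. This uniqueness gives the \<open>THE\<close> in \<open>listing\<close> its
  meaning.\<close>

lemma sorted_wrt_antisym_unique:
  assumes "antisym r" "sorted_wrt (\<lambda>a b. (a, b) \<in> r) xs" "sorted_wrt (\<lambda>a b. (a, b) \<in> r) ys"
    and "distinct xs" "distinct ys" "set xs = set ys"
  shows "xs = ys"
  using assms(2-)
proof (induction xs arbitrary: ys)
  case (Cons x xs)
  then obtain y ys' where ys: "ys = y # ys'" by (cases ys) auto
  have "x = y"
  proof (rule ccontr)
    assume "x \<noteq> y"
    with Cons.prems ys have "x \<in> set ys'" "y \<in> set xs" by auto
    with Cons.prems ys have "(y, x) \<in> r" "(x, y) \<in> r" by auto
    with assms(1) \<open>x \<noteq> y\<close> show False by (auto dest: antisymD)
  qed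
  moreover from this have "set xs = set ys'" using Cons.prems ys by auto
  ultimately show ?case using Cons.IH [of ys'] Cons.prems ys by simp
qed simp

lemma listing_eqI:
  assumes "antisym r" "distinct xs" "set xs = X" "sorted_wrt (\<lambda>a b. (a, b) \<in> r) xs"
  shows "listing r X = xs"
  unfolding listing_def
proof (rule the_equality)
  show "distinct xs \<and> set xs = X \<and> sorted_wrt (\<lambda>a b. (a, b) \<in> r) xs"
    using assms by simp
qed (use assms in \<open>auto intro: sorted_wrt_antisym_unique\<close>)

text \<open>Sorting by the number of predecessors puts a finite set in increasing order.\<close>

lemma ex_listing:
  assumes r: "linear_order_on U r" and X: "finite X" "X \<subseteq> U"
  shows "\<exists>xs. distinct xs \<and> set xs = X \<and> sorted_wrt (\<lambda>a b. (a, b) \<in> r) xs"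
proof -
  define rank where "rank a = card {b \<in> X. (b, a) \<in> r}" for a
  obtain xs where xs: "set xs = X" "distinct xs" using finite_distinct_list [OF X(1)] by blast
  define ys where "ys = sort_key rank xs"
  have ys: "distinct ys" "set ys = X" using xs by (simp_all add: ys_def)
  have R: "refl_on U r" "trans r" "antisym r" "total_on U r"
    using r by (auto simp: order_on_defs)
  have rank: "(a, b) \<in> r" if "a \<in> X" "b \<in> X" "rank a \<le> rank b" for a b
  proof (rule ccontr)
    assume ab: "(a, b) \<notin> r"
    have refl: "(a, a) \<in> r" "(b, b) \<in> r" using that X R(1) by (auto simp: refl_on_def)
    have "a \<noteq> b" using ab refl by blast
    with ab that X R(4) have ba: "(b, a) \<in> r" unfolding total_on_def by blast
    \<comment> \<open>Transitivity gives the inclusion of the predecessor sets. It is strict because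
      \<open>a\<close> precedes itself but, by assumption, not \<open>b\<close>; so the ranks
      contradict \<open>rank a \<le> rank b\<close>.\<close>
    have "{c \<in> X. (c, b) \<in> r} \<subseteq> {c \<in> X. (c, a) \<in> r}"
      using ba R(2) by (auto elim: transE)
    moreover have "a \<in> {c \<in> X. (c, a) \<in> r} - {c \<in> X. (c, b) \<in> r}"
      using ab that refl by auto
    ultimately have "{c \<in> X. (c, b) \<in> r} \<subset> {c \<in> X. (c, a) \<in> r}" by blast
    then have "rank b < rank a" unfolding rank_def using X by (intro psubset_card_mono) auto
    with that show False by simp
  qed
  have "sorted_wrt (\<lambda>a b. rank a \<le> rank b) ys"
    using sorted_sort_key [of rank xs] unfolding ys_def by (simp add: sorted_wrt_map)
  then have "sorted_wrt (\<lambda>a b. (a, b) \<in> r) ys"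
    by (rule sorted_wrt_mono_rel [rotated]) (use rank ys in auto)
  with ys show ?thesis by blast
qed

lemma
  assumes "linear_order_on U r" "finite X" "X \<subseteq> U"
  shows distinct_listing: "distinct (listing r X)"
    and set_listing: "set (listing r X) = X"
    and sorted_listing: "sorted_wrt (\<lambda>a b. (a, b) \<in> r) (listing r X)"
    and length_listing: "length (listing r X) = card X"
proof -
  obtain xs where xs: "distinct xs" "set xs = X" "sorted_wrt (\<lambda>a b. (a, b) \<in> r) xs"
    using ex_listing [OF assms] by blast
  then have "listing r X = xs"
    using assms(1) by (intro listing_eqI) (auto simp: order_on_defs)
  with xs show "distinct (listing r X)" "set (listing r X) = X"
    "sorted_wrt (\<lambda>a b. (a, b) \<in> r) (listing r X)" "length (listing r X) = card X"
    by (auto simp: distinct_card)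
qed

section \<open>Block Laplace expansion\<close>

text \<open>Addressing entries by labels instead of positions lets one function \<open>M\<close>
  serve all submatrices and reorderings: only the two lists change.\<close>

definition indexed_mat :: "('a \<Rightarrow> 'b \<Rightarrow> 'c) \<Rightarrow> 'a list \<Rightarrow> 'b list \<Rightarrow> 'c mat" where
  "indexed_mat M xs ys = Matrix.mat (length xs) (length ys) (\<lambda>(i, j). M (xs ! i) (ys ! j))"

lemma indexed_mat_append:
  "indexed_mat M (xs @ xs') (ys @ ys') = four_block_mat (indexed_mat M xs ys) (indexed_mat M xs ys')
    (indexed_mat M xs' ys) (indexed_mat M xs' ys')"
  by (rule eq_matI) (auto simp: indexed_mat_def nth_append)

text \<open>By induction the last block is split off: its columns vanish on all earlier rows, so the
  matrix is block lower triangular and the determinant factors.\<close>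

lemma det_indexed_mat_blocks:
  fixes M :: "'a \<Rightarrow> 'b \<Rightarrow> 'c :: idom"
  assumes "\<And>j. j < N \<Longrightarrow> length (X j) = length (Y j)"
    and "\<And>i j a b. i < N \<Longrightarrow> j < N \<Longrightarrow> i \<noteq> j \<Longrightarrow> a \<in> set (X i) \<Longrightarrow> b \<in> set (Y j) \<Longrightarrow> M a b = 0"
  shows "Determinant.det (indexed_mat M (concat (map X [0..<N])) (concat (map Y [0..<N]))) =
    (\<Prod>j<N. Determinant.det (indexed_mat M (X j) (Y j)))"
  using assms
proof (induction N)
  case 0
  have "indexed_mat M [] [] \<in> carrier_mat 0 0" by (simp add: indexed_mat_def)
  then show ?case by simp
next
  case (Suc N)
  let ?X = "concat (map X [0..<N])" and ?Y = "concat (map Y [0..<N])"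
  have len: "length ?X = length ?Y"
    using Suc.prems(1) by (auto simp: length_concat intro!: arg_cong [of _ _ sum_list])
  have "M (?X ! i) (Y N ! k) = 0" if "i < length ?X" "k < length (Y N)" for i k
  proof -
    have "?X ! i \<in> set ?X" "Y N ! k \<in> set (Y N)" using that nth_mem by blast+
    moreover from this(1) obtain l where "l < N" "?X ! i \<in> set (X l)" by auto
    ultimately show ?thesis using Suc.prems(2) [of l N] by simp
  qed
  then have "indexed_mat M ?X (Y N) = 0\<^sub>m (length ?X) (length (Y N))"
    by (intro eq_matI) (auto simp: indexed_mat_def)
  then have "Determinant.det (indexed_mat M (?X @ X N) (?Y @ Y N)) =
      Determinant.det (indexed_mat M ?X ?Y) * Determinant.det (indexed_mat M (X N) (Y N))"
    unfolding indexed_mat_append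
    using Suc.prems(1) [of N] len
    by (intro det_four_block_mat_upper_right_zero) (auto simp: indexed_mat_def)
  also have "Determinant.det (indexed_mat M ?X ?Y) =
      (\<Prod>j<N. Determinant.det (indexed_mat M (X j) (Y j)))"
    using Suc.prems by (intro Suc.IH) (metis less_SucI)+
  finally show ?case by simp
qed

lemma det_indexed_mat_permute:
  fixes M :: "'a \<Rightarrow> 'b \<Rightarrow> 'c :: comm_ring_1"
  assumes "p permutes {..<length xs}" "length ys = length xs"
  shows "Determinant.det (indexed_mat M (permute_list p xs) ys) =
    of_int (sign p) * Determinant.det (indexed_mat M xs ys)"
proof -
  have p: "p permutes {0..<length xs}" using assms by (simp add: atLeast0LessThan)
  have "indexed_mat M (permute_list p xs) ys =
    Matrix.mat (length xs) (length xs) (\<lambda>(i, j). indexed_mat M xs ys $$ (p i, j))"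
  proof (rule eq_matI)
    fix i j assume "i < dim_row (Matrix.mat (length xs) (length xs) (\<lambda>(i, j). indexed_mat M xs ys $$ (p i, j)))"
      and "j < dim_col (Matrix.mat (length xs) (length xs) (\<lambda>(i, j). indexed_mat M xs ys $$ (p i, j)))"
    then have ij: "i < length xs" "j < length xs" by simp_all
    moreover from this have "p i < length xs" using permutes_in_image [OF assms(1), of i] by simp
    ultimately show "indexed_mat M (permute_list p xs) ys $$ (i, j) =
        Matrix.mat (length xs) (length xs) (\<lambda>(i, j). indexed_mat M xs ys $$ (p i, j)) $$ (i, j)"
      using permute_list_nth [OF assms(1) ij(1)] assms(2) by (simp add: indexed_mat_def)
  qed (simp_all add: indexed_mat_def assms(2))
  then show ?thesis
    using det_permute_rows [OF _ p, of "indexed_mat M xs ys"] assms(2)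
    by (simp add: indexed_mat_def)
qed

text \<open>In a distinct list an entry determines its position. Hence the permutation described by
  the \<open>THE\<close> in \<open>partition_sign\<close> is unique.\<close>

lemma permute_list_inject:
  assumes "distinct xs" "p permutes {..<length xs}" "q permutes {..<length xs}"
    and "permute_list p xs = permute_list q xs"
  shows "p = q"
proof
  fix i
  show "p i = q i"
  proof (cases "i < length xs")
    case True
    have "xs ! p i = xs ! q i"
      using assms True by (metis permute_list_nth)
    then show ?thesis
      using assms True permutes_in_image [OF assms(2), of i] permutes_in_image [OF assms(3), of i]
      by (simp add: nth_eq_iff_index_eq)
  next
    case False
    then show ?thesis using assms by (simp add: permutes_not_in)
  qed
qed

text \<open>The concatenated parts and the listing of \<open>U\<close> are distinct lists with the
  same elements, so a permutation takes one to the other. It is the one whose sign defines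
  \<open>partition_sign\<close>, and also the row permutation whose sign the determinant picks
  up.\<close>

lemma det_indexed_mat_partition:
  fixes M :: "'a \<Rightarrow> 'b \<Rightarrow> 'c :: comm_ring_1"
  assumes r: "linear_order_on U r" and U: "finite U" and R: "R \<in> ordered_partitions N U c"
    and ys: "length ys = card U"
  shows "Determinant.det (indexed_mat M (listing r U) ys) = of_int (partition_sign r N R) *
    Determinant.det (indexed_mat M (concat (map (\<lambda>j. listing r (R j)) [0..<N])) ys)"
proof -
  let ?xs = "concat (map (\<lambda>j. listing r (R j)) [0..<N])"
  have R': "(\<Union>j<N. R j) = U" "disjoint_family_on R {..<N}" "\<And>j. j < N \<Longrightarrow> R j \<subseteq> U"
    using R by (auto simp: ordered_partitions_def)
  have fin: "finite (R j)" if "j < N" for j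
    using R'(3) [OF that] U by (rule finite_subset)
  note lst = distinct_listing [OF r fin R'(3)] set_listing [OF r fin R'(3)]
  have set: "set ?xs = U" using R'(1) lst(2) by auto
  have "distinct (concat (map (\<lambda>j. listing r (R j)) [0..<n]))" if "n \<le> N" for n
    using that
  proof (induction n)
    case (Suc n)
    have "R n \<inter> R j = {}" if "j < n" for j
      using R'(2) that Suc.prems by (auto simp: disjoint_family_on_def)
    moreover have "set (listing r (R j)) = R j" if "j \<le> n" for j
      using lst(2) that Suc.prems by simp
    ultimately show ?case using Suc lst(1) by fastforce
  qed simp
  then have dist: "distinct ?xs" by simp
  have U_list: "distinct (listing r U)" "set (listing r U) = U"
    using distinct_listing [OF r U] set_listing [OF r U] by auto
  have "mset (listing r U) = mset ?xs"
    using dist U_list set by (simp only: set_eq_iff_mset_eq_distinct [symmetric])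
  then obtain p where p: "p permutes {..<length ?xs}" "permute_list p ?xs = listing r U"
    by (rule mset_eq_permutation)
  then have "(THE p. p permutes {..<length ?xs} \<and> permute_list p ?xs = listing r U) = p"
    using permute_list_inject [OF dist] by (intro the_equality) auto
  then have "partition_sign r N R = sign p"
    by (simp only: partition_sign_def Let_def R'(1))
  moreover have "length ys = length ?xs"
    using ys dist set distinct_card by metis
  ultimately show ?thesis
    using det_indexed_mat_permute [OF p(1), of ys M] p(2) by simp
qed

section \<open>Row assignments and ordered partitions\<close>

lemma ordered_partitions_fibres:
  assumes "\<rho> \<in> U \<rightarrow>\<^sub>E {..<N}"
  shows "(\<lambda>j\<in>{..<N}. {a \<in> U. \<rho> a = j}) \<in> ordered_partitions N U c \<longleftrightarrow>
    (\<forall>j<N. card {a \<in> U. \<rho> a = j} = c j)"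
  using assms by (auto simp: ordered_partitions_def disjoint_family_on_def)

text \<open>The expansion produces a sum over assignments \<open>\<rho>\<close> of rows to blocks,
  while the formula sums over partitions; taking fibres reindexes one into the other. Fibres cover
  \<open>U\<close> and are disjoint automatically, so only their cardinalities have to be
  prescribed.\<close>

lemma bij_betw_fibres:
  "bij_betw (\<lambda>\<rho>. \<lambda>j\<in>{..<N}. {a \<in> U. \<rho> a = j})
    {\<rho> \<in> U \<rightarrow>\<^sub>E {..<N}. \<forall>j<N. card {a \<in> U. \<rho> a = j} = c j} (ordered_partitions N U c)"
proof (rule bij_betwI')
  fix \<rho> \<tau>
  assume "\<rho> \<in> {\<rho> \<in> U \<rightarrow>\<^sub>E {..<N}. \<forall>j<N. card {a \<in> U. \<rho> a = j} = c j}"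
    and "\<tau> \<in> {\<rho> \<in> U \<rightarrow>\<^sub>E {..<N}. \<forall>j<N. card {a \<in> U. \<rho> a = j} = c j}"
  then have \<rho>: "\<rho> \<in> U \<rightarrow>\<^sub>E {..<N}" and \<tau>: "\<tau> \<in> U \<rightarrow>\<^sub>E {..<N}" by simp_all
  show "((\<lambda>j\<in>{..<N}. {a \<in> U. \<rho> a = j}) = (\<lambda>j\<in>{..<N}. {a \<in> U. \<tau> a = j})) = (\<rho> = \<tau>)"
  proof
    assume eq: "(\<lambda>j\<in>{..<N}. {a \<in> U. \<rho> a = j}) = (\<lambda>j\<in>{..<N}. {a \<in> U. \<tau> a = j})"
    show "\<rho> = \<tau>"
    proof (rule PiE_ext [OF \<rho> \<tau>])
      fix a assume a: "a \<in> U"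
      then have "\<rho> a < N" using \<rho> by auto
      with fun_cong [OF eq, of "\<rho> a"] have "{b \<in> U. \<rho> b = \<rho> a} = {b \<in> U. \<tau> b = \<rho> a}"
        by simp
      with a have "a \<in> {b \<in> U. \<tau> b = \<rho> a}" by blast
      then show "\<rho> a = \<tau> a" by simp
    qed
  qed simp
next
  fix \<rho> assume "\<rho> \<in> {\<rho> \<in> U \<rightarrow>\<^sub>E {..<N}. \<forall>j<N. card {a \<in> U. \<rho> a = j} = c j}"
  then show "(\<lambda>j\<in>{..<N}. {a \<in> U. \<rho> a = j}) \<in> ordered_partitions N U c"
    by (subst ordered_partitions_fibres) simp_all
next
  fix R assume R: "R \<in> ordered_partitions N U c"
  then have R': "R \<in> {..<N} \<rightarrow>\<^sub>E Pow U" "(\<Union>j<N. R j) = U" "disjoint_family_on R {..<N}"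
    by (auto simp: ordered_partitions_def)
  \<comment> \<open>The inverse sends \<open>a\<close> to the index of its part. Covering makes the
    choice possible, disjointness makes it unique, and the restriction makes \<open>\<rho>\<close>
    extensional on \<open>U\<close>.\<close>
  define \<rho> where "\<rho> = (\<lambda>a\<in>U. SOME j. j < N \<and> a \<in> R j)"
  have \<rho>: "\<rho> a < N \<and> a \<in> R (\<rho> a)" if "a \<in> U" for a
  proof -
    have "\<exists>j. j < N \<and> a \<in> R j" using that R'(2) by blast
    then have "(SOME j. j < N \<and> a \<in> R j) < N \<and> a \<in> R (SOME j. j < N \<and> a \<in> R j)"
      by (rule someI_ex)
    with that show ?thesis by (simp add: \<rho>_def)
  qed
  have "\<rho> a = j" if "j < N" "a \<in> R j" for a j
  proof (rule ccontr)
    assume ne: "\<rho> a \<noteq> j"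
    have "a \<in> U" using that R'(2) by blast
    then have "\<rho> a < N" "a \<in> R (\<rho> a)" using \<rho> by auto
    with ne that R'(3) show False by (auto simp: disjoint_family_on_def)
  qed
  with \<rho> R'(2) have fib: "{a \<in> U. \<rho> a = j} = R j" if "j < N" for j
    using that by blast
  have P: "\<rho> \<in> U \<rightarrow>\<^sub>E {..<N}" using \<rho> by (auto simp: \<rho>_def)
  have eq: "R = (\<lambda>j\<in>{..<N}. {a \<in> U. \<rho> a = j})"
    by (rule PiE_ext [OF R'(1)]) (auto simp: fib)
  with R have "(\<lambda>j\<in>{..<N}. {a \<in> U. \<rho> a = j}) \<in> ordered_partitions N U c" by (simp only:)
  then have "\<forall>j<N. card {a \<in> U. \<rho> a = j} = c j" using ordered_partitions_fibres [OF P] by blast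
  with P eq show "\<exists>\<rho>\<in>{\<rho> \<in> U \<rightarrow>\<^sub>E {..<N}. \<forall>j<N. card {a \<in> U. \<rho> a = j} = c j}.
      R = (\<lambda>j\<in>{..<N}. {a \<in> U. \<rho> a = j})" by blast
qed

text \<open>The rows of \<open>M\<close> are the sums over \<open>j\<close> of their restrictions to the columns of block \<open>j\<close>;
  \<open>\<rho>\<close> selects one summand in each row.\<close>

definition masked :: "('a \<Rightarrow> nat) \<Rightarrow> ('a \<Rightarrow> nat \<times> 'b \<Rightarrow> 'c :: zero) \<Rightarrow> 'a \<Rightarrow> nat \<times> 'b \<Rightarrow> 'c" where
  "masked \<rho> M a k = (if \<rho> a = fst k then M a k else 0)"

text \<open>Every factor of a Leibniz term is the sum of its masked versions over all blocks, of
  which only the one for the block of its column can be nonzero. Distributing the product over these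
  sums gives one term per \<open>\<rho>\<close>. As the row labels are distinct, a function on
  labels is the same as a choice for each row.\<close>

lemma det_indexed_mat_masked_sum:
  fixes M :: "'a \<Rightarrow> nat \<times> 'b \<Rightarrow> 'c :: comm_ring_1"
  assumes xs: "distinct xs" and len: "length ys = length xs" and ys: "fst ` set ys \<subseteq> {..<N}"
  shows "Determinant.det (indexed_mat M xs ys) =
    (\<Sum>\<rho>\<in>set xs \<rightarrow>\<^sub>E {..<N}. Determinant.det (indexed_mat (masked \<rho> M) xs ys))"
proof -
  let ?n = "length xs"
  let ?T = "{0..<?n}"
  have det: "Determinant.det (indexed_mat M' xs ys) =
      (\<Sum>p | p permutes ?T. signof p * (\<Prod>i\<in>?T. M' (xs ! i) (ys ! p i)))" for M' :: "'a \<Rightarrow> nat \<times> 'b \<Rightarrow> 'c"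
  proof -
    have "Determinant.det (indexed_mat M' xs ys) =
      (\<Sum>p | p permutes ?T. signof p * (\<Prod>i\<in>?T. indexed_mat M' xs ys $$ (i, p i)))"
      by (rule det_def') (use len in \<open>simp add: indexed_mat_def\<close>)
    also have "\<dots> = (\<Sum>p | p permutes ?T. signof p * (\<Prod>i\<in>?T. M' (xs ! i) (ys ! p i)))"
    proof (rule sum.cong [OF refl])
      fix p assume "p \<in> {p. p permutes ?T}"
      then have "p i < ?n" if "i < ?n" for i
        using that permutes_in_image [of p ?T i] by simp
      then show "signof p * (\<Prod>i\<in>?T. indexed_mat M' xs ys $$ (i, p i)) =
          signof p * (\<Prod>i\<in>?T. M' (xs ! i) (ys ! p i))"
        using len by (simp add: indexed_mat_def)
    qed
    finally show ?thesis .
  qed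
  have bij: "bij_betw ((!) xs) ?T (set xs)"
    using xs by (intro bij_betw_nth) auto
  have "(\<Prod>i\<in>?T. M (xs ! i) (ys ! p i)) =
      (\<Sum>\<rho>\<in>set xs \<rightarrow>\<^sub>E {..<N}. \<Prod>i\<in>?T. masked \<rho> M (xs ! i) (ys ! p i))"
    if p: "p permutes ?T" for p
  proof -
    \<comment> \<open>\<open>h a\<close> is the column that \<open>p\<close> matches with the row
      labelled \<open>a\<close>. It moves the product from positions to labels, where the
      assignments \<open>\<rho>\<close> live.\<close>
    define h where "h a = ys ! p (the_inv_into ?T ((!) xs) a)" for a
    have h: "h (xs ! i) = ys ! p i" if "i \<in> ?T" for i
      using that bij by (simp add: h_def bij_betw_def the_inv_into_f_f)
    have "fst (h a) < N" if "a \<in> set xs" for a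
    proof -
      obtain i where i: "i \<in> ?T" "a = xs ! i"
        using \<open>a \<in> set xs\<close> by (metis atLeastLessThan_iff in_set_conv_nth zero_le)
      then have "p i < length ys" using p len permutes_in_image [of p ?T i] by simp
      then show ?thesis using i h ys nth_mem by fastforce
    qed
    then have delta: "M a (h a) = (\<Sum>j<N. if j = fst (h a) then M a (h a) else 0)" if "a \<in> set xs" for a
      using that by simp
    have "(\<Prod>i\<in>?T. M (xs ! i) (ys ! p i)) = (\<Prod>i\<in>?T. M (xs ! i) (h (xs ! i)))"
      by (intro prod.cong refl) (simp only: h)
    also have "\<dots> = (\<Prod>a\<in>set xs. M a (h a))"
      by (rule prod.reindex_bij_betw [OF bij])
    also have "\<dots> = (\<Prod>a\<in>set xs. \<Sum>j<N. if j = fst (h a) then M a (h a) else 0)"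
      by (intro prod.cong refl delta)
    also have "\<dots> = (\<Sum>\<rho>\<in>set xs \<rightarrow>\<^sub>E {..<N}. \<Prod>a\<in>set xs. masked \<rho> M a (h a))"
      unfolding masked_def by (rule prod_sum_PiE) simp_all
    also have "\<dots> = (\<Sum>\<rho>\<in>set xs \<rightarrow>\<^sub>E {..<N}. \<Prod>i\<in>?T. masked \<rho> M (xs ! i) (h (xs ! i)))"
      by (intro sum.cong refl prod.reindex_bij_betw [OF bij, symmetric])
    also have "\<dots> = (\<Sum>\<rho>\<in>set xs \<rightarrow>\<^sub>E {..<N}. \<Prod>i\<in>?T. masked \<rho> M (xs ! i) (ys ! p i))"
      by (intro sum.cong prod.cong refl) (simp only: h)
    finally show ?thesis .
  qed
  then have "Determinant.det (indexed_mat M xs ys) = (\<Sum>p | p permutes ?T.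
      \<Sum>\<rho>\<in>set xs \<rightarrow>\<^sub>E {..<N}. signof p * (\<Prod>i\<in>?T. masked \<rho> M (xs ! i) (ys ! p i)))"
    unfolding det by (intro sum.cong refl) (simp add: sum_distrib_left)
  also have "\<dots> = (\<Sum>\<rho>\<in>set xs \<rightarrow>\<^sub>E {..<N}. \<Sum>p | p permutes ?T.
      signof p * (\<Prod>i\<in>?T. masked \<rho> M (xs ! i) (ys ! p i)))"
    by (rule sum.swap)
  finally show ?thesis by (simp only: det)
qed

text \<open>A nonzero Leibniz term matches each row \<open>a\<close> with a column of block
  \<open>\<rho> a\<close>. The block numbers of rows and columns then agree as multisets, so each
  block has as many rows as columns.\<close>

lemma det_indexed_mat_masked_eq_0:
  fixes M :: "'a \<Rightarrow> nat \<times> 'b \<Rightarrow> 'c :: idom"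
  assumes len: "length ys = length xs"
    and ne: "length (filter (\<lambda>a. \<rho> a = j) xs) \<noteq> length (filter (\<lambda>k. fst k = j) ys)"
  shows "Determinant.det (indexed_mat (masked \<rho> M) xs ys) = 0"
proof -
  let ?A = "indexed_mat (masked \<rho> M) xs ys"
  have zero: "(\<Prod>i = 0..<length xs. ?A $$ (i, p i)) = 0" if p: "p permutes {0..<length xs}" for p
  proof (rule ccontr)
    assume nz: "(\<Prod>i = 0..<length xs. ?A $$ (i, p i)) \<noteq> 0"
    have p': "p permutes {..<length ys}" using p len by (simp add: atLeast0LessThan)
    have "\<rho> (xs ! i) = fst (ys ! p i)" if "i < length xs" for i
    proof -
      have "?A $$ (i, p i) \<noteq> 0" using nz that by auto
      moreover have "p i < length ys"
        using that len permutes_in_image [OF p', of i] by simp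
      ultimately show ?thesis using that by (auto simp: indexed_mat_def masked_def split: if_splits)
    qed
    then have "map \<rho> xs = map fst (permute_list p ys)"
      using p' len by (auto intro!: nth_equalityI simp: permute_list_nth)
    then have "mset (map \<rho> xs) = mset (map fst ys)"
      using p' by (simp add: mset_map)
    then have "length (filter (\<lambda>l. l = j) (map \<rho> xs)) = length (filter (\<lambda>l. l = j) (map fst ys))"
      by (metis mset_filter size_mset)
    with ne show False by (simp add: filter_map o_def)
  qed
  have "?A \<in> carrier_mat (length xs) (length xs)"
    using len by (simp add: indexed_mat_def)
  then show ?thesis
    by (subst det_def', assumption)
      (intro sum.neutral ballI, simp only: mem_Collect_eq zero mult_zero_right)
qed

text \<open>The columns arrive grouped by block and carry the block number as first component, so
  the sign comes from sorting the rows alone.\<close>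

theorem Laplace_expansion_blocks:
  fixes M :: "'a \<Rightarrow> nat \<times> 'b \<Rightarrow> 'c :: idom"
  assumes r: "linear_order_on U r" and U: "finite U" and Y: "(\<Sum>j<N. length (Y j)) = card U"
  shows "Determinant.det (indexed_mat M (listing r U) (concat (map (\<lambda>j. map (Pair j) (Y j)) [0..<N]))) =
    (\<Sum>R\<in>ordered_partitions N U (\<lambda>j. length (Y j)). of_int (partition_sign r N R) *
      (\<Prod>j<N. Determinant.det (indexed_mat (\<lambda>a b. M a (j, b)) (listing r (R j)) (Y j))))"
proof -
  let ?ys = "concat (map (\<lambda>j. map (Pair j) (Y j)) [0..<N])"
  let ?D = "\<lambda>\<rho>. Determinant.det (indexed_mat (masked \<rho> M) (listing r U) ?ys)"
  let ?good = "{\<rho> \<in> U \<rightarrow>\<^sub>E {..<N}. \<forall>j<N. card {a \<in> U. \<rho> a = j} = length (Y j)}"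
  note LU = distinct_listing [OF r U subset_refl] set_listing [OF r U subset_refl]
    length_listing [OF r U subset_refl]
  have len_ys: "length ?ys = card U"
    using Y by (simp add: length_concat o_def interv_sum_list_conv_sum_set_nat atLeast0LessThan)
  have filter_ys: "length (filter (\<lambda>k. fst k = j) ?ys) = length (Y j)" if "j < N" for j
  proof -
    have "length (filter (\<lambda>k. fst k = j) (map (Pair i) (Y i))) = (if i = j then length (Y i) else 0)" for i
      by (auto simp: filter_map o_def)
    then have "length (filter (\<lambda>k. fst k = j) ?ys) = (\<Sum>i<N. if i = j then length (Y i) else 0)"
      by (simp only: filter_concat length_concat map_map o_def interv_sum_list_conv_sum_set_nat
          set_upt atLeast0LessThan)
    with that show ?thesis by simp
  qed
  have "Determinant.det (indexed_mat M (listing r U) ?ys) = (\<Sum>\<rho>\<in>U \<rightarrow>\<^sub>E {..<N}. ?D \<rho>)"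
    using det_indexed_mat_masked_sum [OF LU(1), of ?ys N M] LU len_ys by fastforce
  also have "\<dots> = sum ?D ?good"
  proof (rule sum.mono_neutral_right)
    show "finite (U \<rightarrow>\<^sub>E {..<N})" using U by (intro finite_PiE) auto
    show "\<forall>\<rho> \<in> (U \<rightarrow>\<^sub>E {..<N}) - ?good. ?D \<rho> = 0"
    proof
      fix \<rho> assume "\<rho> \<in> (U \<rightarrow>\<^sub>E {..<N}) - ?good"
      then obtain j where j: "j < N" "card {a \<in> U. \<rho> a = j} \<noteq> length (Y j)" by blast
      have "length (filter (\<lambda>a. \<rho> a = j) (listing r U)) = card {a \<in> U. \<rho> a = j}"
        using LU by (simp add: distinct_length_filter Int_def conj_commute)
      with j filter_ys show "?D \<rho> = 0"
        using LU len_ys by (intro det_indexed_mat_masked_eq_0 [where j = j]) simp_all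
    qed
  qed auto
  also have "\<dots> = (\<Sum>\<rho>\<in>?good. of_int (partition_sign r N (\<lambda>j\<in>{..<N}. {a \<in> U. \<rho> a = j})) *
      (\<Prod>j<N. Determinant.det (indexed_mat (\<lambda>a b. M a (j, b))
        (listing r ((\<lambda>j\<in>{..<N}. {a \<in> U. \<rho> a = j}) j)) (Y j))))"
  proof (rule sum.cong [OF refl])
    fix \<rho> assume \<rho>: "\<rho> \<in> ?good"
    define R where "R = (\<lambda>j\<in>{..<N}. {a \<in> U. \<rho> a = j})"
    have R: "R \<in> ordered_partitions N U (\<lambda>j. length (Y j))"
      unfolding R_def using \<rho> by (subst ordered_partitions_fibres) simp_all
    have Rj: "R j = {a \<in> U. \<rho> a = j}" if "j < N" for j
      using that by (simp add: R_def)
    then have sub: "R j \<subseteq> U" "finite (R j)" if "j < N" for j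
      using that U by auto
    note LR = set_listing [OF r sub(2,1)] length_listing [OF r sub(2,1)]
    have "?D \<rho> = of_int (partition_sign r N R) * Determinant.det (indexed_mat (masked \<rho> M)
        (concat (map (\<lambda>j. listing r (R j)) [0..<N])) ?ys)"
      by (rule det_indexed_mat_partition [OF r U R len_ys])
    also have "Determinant.det (indexed_mat (masked \<rho> M)
        (concat (map (\<lambda>j. listing r (R j)) [0..<N])) ?ys) =
        (\<Prod>j<N. Determinant.det (indexed_mat (masked \<rho> M) (listing r (R j)) (map (Pair j) (Y j))))"
    proof (rule det_indexed_mat_blocks)
      fix j assume "j < N"
      then show "length (listing r (R j)) = length (map (Pair j) (Y j))"
        using \<rho> LR(2) [of j] Rj by auto
    next
      fix i j a k assume "i < N" "i \<noteq> j" "a \<in> set (listing r (R i))" "k \<in> set (map (Pair j) (Y j))"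
      moreover from this have "a \<in> {a \<in> U. \<rho> a = i}" using LR(1) [of i] Rj [of i] by simp
      ultimately show "masked \<rho> M a k = 0" by (auto simp: masked_def)
    qed
    \<comment> \<open>Inside diagonal block \<open>j\<close> all rows are assigned to
      \<open>j\<close>, so the mask leaves every entry unchanged.\<close>
    also have "\<dots> = (\<Prod>j<N. Determinant.det (indexed_mat (\<lambda>a b. M a (j, b)) (listing r (R j)) (Y j)))"
    proof (rule prod.cong [OF refl])
      fix j assume "j \<in> {..<N}"
      then have "\<rho> a = j" if "a \<in> set (listing r (R j))" for a
        using that LR(1) [of j] Rj [of j] \<open>j \<in> {..<N}\<close> by auto
      then have "indexed_mat (masked \<rho> M) (listing r (R j)) (map (Pair j) (Y j)) =
          indexed_mat (\<lambda>a b. M a (j, b)) (listing r (R j)) (Y j)"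
        by (intro eq_matI) (auto simp: indexed_mat_def masked_def)
      then show "Determinant.det (indexed_mat (masked \<rho> M) (listing r (R j)) (map (Pair j) (Y j))) =
          Determinant.det (indexed_mat (\<lambda>a b. M a (j, b)) (listing r (R j)) (Y j))" by simp
    qed
    finally show "?D \<rho> = of_int (partition_sign r N (\<lambda>j\<in>{..<N}. {a \<in> U. \<rho> a = j})) *
      (\<Prod>j<N. Determinant.det (indexed_mat (\<lambda>a b. M a (j, b))
        (listing r ((\<lambda>j\<in>{..<N}. {a \<in> U. \<rho> a = j}) j)) (Y j)))" unfolding R_def .
  qed
  also have "\<dots> = (\<Sum>R\<in>ordered_partitions N U (\<lambda>j. length (Y j)). of_int (partition_sign r N R) *
      (\<Prod>j<N. Determinant.det (indexed_mat (\<lambda>a b. M a (j, b)) (listing r (R j)) (Y j))))"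
    by (rule sum.reindex_bij_betw [OF bij_betw_fibres])
  finally show ?thesis .
qed

section \<open>Boundedness and holomorphy of the entries\<close>

lemma norm_slice_point:
  "norm (Re z, Im z *\<^sub>R axis i 1 :: real ^ 'n) = cmod z"
  by (simp add: norm_Pair cmod_def norm_axis_1)

lemma vector1_axis: "vector1 (axis i 1) = gen i"
proof -
  have "vec_nth (axis i 1) j *\<^sub>R gen j = (if j = i then gen i else 0)" for j
    by (simp add: axis_def)
  then show ?thesis by (simp add: vector1_def)
qed

lemma \<sigma>_idx1: "idx1 \<notin> A \<Longrightarrow> \<sigma> {idx1} A = 0"
  by (rule \<sigma>_singleton_less) (metis Min_le UNIV_I finite idx1_def less_le)

text \<open>On this pair of coordinates \<open>gen idx1\<close> acts as the imaginary unit acts on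
  real and imaginary part. Since \<open>idx1\<close> is the least index, moving it to the front of a
  blade costs no sign; the minus comes from its square.\<close>

lemma coord_gen_idx1_mult:
  fixes A :: "'n::{finite,linorder} set"
  assumes "idx1 \<notin> A"
  shows "coord (gen idx1 * x) A = - coord x (insert idx1 A)"
    and "coord (gen idx1 * x) (insert idx1 A) = coord x A"
proof -
  have A: "sym_diff {idx1} A = insert idx1 A" "sym_diff {idx1} (insert idx1 A) = A"
    using assms by auto
  have "(- 1 :: real) ^ \<sigma> {idx1} (sym_diff {idx1} A) = (- 1) ^ \<sigma> {idx1 :: 'n} {idx1} * (- 1) ^ \<sigma> {idx1} A"
    by (rule \<sigma>_sym_diff(2))
  also have "(- 1 :: real) ^ \<sigma> {idx1 :: 'n} {idx1} = - 1"
    unfolding minus_one_power_\<sigma> by simp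
  finally show "coord (gen idx1 * x) A = - coord x (insert idx1 A)"
    unfolding coord_gen_mult using assms A(1) by (simp add: \<sigma>_idx1)
  show "coord (gen idx1 * x) (insert idx1 A) = coord x A"
    unfolding coord_gen_mult A(2) using assms by (simp add: \<sigma>_idx1)
qed

lemma abs_coord_le_norm: "\<bar>coord x A\<bar> \<le> norm x"
proof -
  have "(coord x A)\<^sup>2 \<le> (\<Sum>B\<in>UNIV. (coord x B)\<^sup>2)"
    by (rule member_le_sum) simp_all
  then have "sqrt ((coord x A)\<^sup>2) \<le> sqrt (\<Sum>B\<in>UNIV. (coord x B)\<^sup>2)"
    by (rule real_sqrt_le_mono)
  then show ?thesis
    by (simp add: norm_clifford_def inner_clifford_def power2_eq_square [symmetric])
qed

lemma bounded_linear_coord: "bounded_linear (\<lambda>x. coord x A)"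
  by (rule bounded_linear_intro [where K = 1]) (simp_all add: abs_coord_le_norm)

text \<open>On \<open>\<complex>\<^sub>I\<close>, the equation \<open>\<partial>\<^sub>u f + I \<partial>\<^sub>v f = 0\<close> compared at the coordinates \<open>A\<close> and
  \<open>A \<union> {1}\<close> is the pair of Cauchy-Riemann equations for \<open>F\<^sub>A\<close>.\<close>

lemma component_holomorphic:
  fixes f :: "'n paravector \<Rightarrow> 'n::{finite,linorder} clifford"
  assumes f: "slice_monogenic f" and A: "idx1 \<notin> A"
  shows "component f A holomorphic_on ball 0 1"
proof (rule holomorphic_onI)
  fix z :: complex assume z: "z \<in> ball 0 1"
  let ?e = "axis idx1 1 :: real ^ ('n::{finite,linorder})"
  let ?\<phi> = "\<lambda>z. (Re z, Im z *\<^sub>R ?e)"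
  have ball: "?\<phi> z \<in> ball 0 1" using z by (simp add: norm_slice_point)
  then obtain D where D: "(f has_derivative D) (at (?\<phi> z))"
    using f unfolding slice_monogenic_def differentiable_def by blast
  interpret D: bounded_linear D by (rule has_derivative_bounded_linear [OF D])
  have d\<phi>: "(?\<phi> has_derivative ?\<phi>) (at z)"
    by (auto intro!: derivative_eq_intros)
  have "((\<lambda>t. (t, Im z *\<^sub>R ?e)) has_derivative (\<lambda>h. (h, 0))) (at (Re z))"
    by (auto intro!: derivative_eq_intros)
  from has_derivative_compose [OF this D]
  have "((\<lambda>t. f (t, Im z *\<^sub>R ?e)) has_derivative (\<lambda>h. D (h, 0))) (at (Re z))" .
  moreover have "(\<lambda>h. D (h, 0)) = (\<lambda>h. h *\<^sub>R D (1, 0))"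
    by (rule ext) (simp flip: D.scaleR)
  ultimately have u: "vector_derivative (\<lambda>t. f (t, Im z *\<^sub>R ?e)) (at (Re z)) = D (1, 0)"
    by (intro vector_derivative_at) (simp only: has_vector_derivative_def)
  have "((\<lambda>t. (Re z, t *\<^sub>R ?e)) has_derivative (\<lambda>h. (0, h *\<^sub>R ?e))) (at (Im z))"
    by (auto intro!: derivative_eq_intros)
  from has_derivative_compose [OF this D]
  have "((\<lambda>t. f (Re z, t *\<^sub>R ?e)) has_derivative (\<lambda>h. D (0, h *\<^sub>R ?e))) (at (Im z))" .
  moreover have De: "D (0, h *\<^sub>R ?e) = h *\<^sub>R D (0, ?e)" for h
    using D.scaleR [of h "(0, ?e)"] by simp
  ultimately have v: "vector_derivative (\<lambda>t. f (Re z, t *\<^sub>R ?e)) (at (Im z)) = D (0, ?e)"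
    by (intro vector_derivative_at) (simp add: has_vector_derivative_def)
  have "norm ?e = 1" by (simp add: norm_axis_1)
  with f ball have "(1 / 2) *\<^sub>R (vector_derivative (\<lambda>t. f (t, Im z *\<^sub>R ?e)) (at (Re z))
      + vector1 ?e * vector_derivative (\<lambda>t. f (Re z, t *\<^sub>R ?e)) (at (Im z))) = 0"
    unfolding slice_monogenic_def by blast
  then have "D (1, 0) + gen idx1 * D (0, ?e) = 0"
    unfolding u v vector1_axis by simp
  then have zero: "coord (D (1, 0)) B + coord (gen idx1 * D (0, ?e)) B = 0" for B
    by (metis coord_simps(1,2))
  have CR: "coord (D (1, 0)) A = coord (D (0, ?e)) (insert idx1 A)"
    "coord (D (1, 0)) (insert idx1 A) = - coord (D (0, ?e)) A"
    using zero [of A] zero [of "insert idx1 A"] by (simp_all add: coord_gen_idx1_mult [OF A])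
  have D\<phi>: "D (?\<phi> h) = Re h *\<^sub>R D (1, 0) + Im h *\<^sub>R D (0, ?e)" for h
    using D.add [of "(Re h, 0)" "(0, Im h *\<^sub>R ?e)"] D.scaleR [of "Re h" "(1, 0)"] De by simp
  have "(slice f has_derivative (\<lambda>h. D (?\<phi> h))) (at z)"
    unfolding slice_def by (rule has_derivative_compose [OF d\<phi> D])
  then have dc: "((\<lambda>z. coord (slice f z) B) has_derivative (\<lambda>h. coord (D (?\<phi> h)) B)) (at z)" for B
    by (rule bounded_linear.has_derivative [OF bounded_linear_coord])
  \<comment> \<open>The candidate for the complex derivative is the partial derivative in the real
    direction. By \<open>CR\<close>, the real-linear derivative of the component is multiplication
    by it.\<close>
  let ?c = "Complex (coord (D (1, 0)) A) (coord (D (1, 0)) (insert idx1 A))"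
  have "component f A = (\<lambda>z. complex_of_real (coord (slice f z) A) +
      \<i> * complex_of_real (coord (slice f z) (insert idx1 A)))"
    by (simp add: fun_eq_iff component_def complex_eq_iff)
  moreover have "((\<lambda>z. complex_of_real (coord (slice f z) A) +
      \<i> * complex_of_real (coord (slice f z) (insert idx1 A))) has_derivative
      (\<lambda>h. complex_of_real (coord (D (?\<phi> h)) A) +
      \<i> * complex_of_real (coord (D (?\<phi> h)) (insert idx1 A)))) (at z)"
    by (intro derivative_intros dc)
  moreover have "(\<lambda>h. complex_of_real (coord (D (?\<phi> h)) A) +
      \<i> * complex_of_real (coord (D (?\<phi> h)) (insert idx1 A))) = (*) ?c"
    unfolding D\<phi> using CR by (simp add: fun_eq_iff complex_eq_iff algebra_simps)
  ultimately have "(component f A has_field_derivative ?c) (at z)"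
    by (simp only: has_field_derivative_def)
  then show "component f A field_differentiable at z within ball 0 1"
    by (meson field_differentiable_at_within field_differentiable_def)
qed

lemma component_bounded:
  fixes f :: "'n paravector \<Rightarrow> 'n::{finite,linorder} clifford"
  assumes "bounded (f ` ball 0 1)"
  shows "bounded (component f A ` ball 0 1)"
proof -
  obtain b where b: "\<And>x. x \<in> ball 0 1 \<Longrightarrow> norm (f x) \<le> b"
    using assms unfolding bounded_iff by blast
  have "cmod (component f A z) \<le> b + b" if "z \<in> ball 0 1" for z
  proof -
    have "norm (slice f z) \<le> b"
      unfolding slice_def using that by (intro b) (simp add: norm_slice_point)
    moreover have "cmod (component f A z) \<le>
        \<bar>coord (slice f z) A\<bar> + \<bar>coord (slice f z) (insert idx1 A)\<bar>"
      using cmod_le [of "component f A z"] by (simp add: component_def)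
    ultimately show ?thesis
      using abs_coord_le_norm [of "slice f z" A] abs_coord_le_norm [of "slice f z" "insert idx1 A"]
      by linarith
  qed
  then show ?thesis unfolding bounded_iff by blast
qed

text \<open>This is Schwarz reflection: the disc is invariant under conjugation, and conjugating
  both argument and value preserves holomorphy and modulus bounds.\<close>

lemma hat_H_infinity:
  assumes "F \<in> H_infinity"
  shows "hat F \<in> H_infinity"
proof -
  have ball: "cnj ` ball 0 1 = ball 0 1"
    unfolding image_cnj_conv_vimage_cnj by auto
  have hat: "hat F = cnj \<circ> F \<circ> cnj" by (simp add: fun_eq_iff hat_def)
  have "hat F holomorphic_on ball 0 1"
    unfolding hat using assms ball
    by (intro holomorphic_on_compose_cnj_cnj) (simp_all add: H_infinity_def)
  moreover have "bounded (hat F ` ball 0 1)"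
  proof -
    obtain b where "\<And>z. z \<in> ball 0 1 \<Longrightarrow> cmod (F z) \<le> b"
      using assms unfolding H_infinity_def bounded_iff by blast
    then show ?thesis
      by (auto simp: bounded_iff hat_def intro!: exI [of _ b])
  qed
  ultimately show ?thesis by (simp add: H_infinity_def)
qed

lemma matrix_entry_H_infinity:
  assumes f: "slice_monogenic f" "bounded (f ` ball 0 1)"
    and AB: "A \<in> multi_indices" "B \<in> multi_indices"
  shows "(\<lambda>z. matrix_entry f z A B) \<in> H_infinity"
proof -
  let ?F = "component f (sym_diff A B)"
  \<comment> \<open>Neither \<open>A\<close> nor \<open>B\<close> contains \<open>idx1\<close>,
    hence neither does their symmetric difference, as \<open>component_holomorphic\<close>
    demands.\<close>
  have "?F \<in> H_infinity"
    using component_holomorphic [OF f(1), of "sym_diff A B"] component_bounded [OF f(2)] AB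
    by (auto simp: H_infinity_def multi_indices_def)
  define G where "G = (if even (card A) then ?F else hat ?F)"
  have G: "G \<in> H_infinity"
    using \<open>?F \<in> H_infinity\<close> by (simp add: G_def hat_H_infinity)
  have "(\<lambda>z. matrix_entry f z A B) = (\<lambda>z. (- 1) ^ \<sigma> (sym_diff A B) B * G z)"
    by (simp add: fun_eq_iff matrix_entry_def G_def)
  moreover have "(\<lambda>z. c * G z) \<in> H_infinity" for c
  proof -
    have "(\<lambda>z. c * G z) ` ball 0 1 = (*) c ` (G ` ball 0 1)" by (simp add: image_image)
    with G show ?thesis unfolding H_infinity_def
      by (auto intro!: holomorphic_intros bounded_linear_image bounded_linear_mult_right)
  qed
  ultimately show ?thesis by simp
qed

section \<open>Minors of the block matrix\<close>

text \<open>This brings the column numbers into the block-by-block form in which the Laplace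
  expansion takes its columns.\<close>

lemma upt_mult_concat: "[0..<N * m] = concat (map (\<lambda>j. map (\<lambda>k. j * m + k) [0..<m]) [0..<N])"
proof (induction N)
  case (Suc N)
  have "[0..<Suc N * m] = [0..<N * m] @ [N * m..<N * m + m]"
    using upt_add_eq_append [of 0 "N * m" m] by (simp add: add.commute)
  also have "[N * m..<N * m + m] = map (\<lambda>k. N * m + k) [0..<m]"
    using map_add_upt [of "N * m" m] by (simp add: add.commute)
  finally show ?case using Suc.IH by simp
qed simp

text \<open>As a filter, the sorted enumeration of \<open>S\<close> commutes with concatenation and
  can be split into blocks.\<close>

lemma sorted_list_of_set_conv_filter:
  assumes "S \<subseteq> {..<n}"
  shows "sorted_list_of_set S = filter (\<lambda>k. k \<in> S) [0..<n]"
proof (rule sorted_distinct_set_unique)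
  have "finite S" using assms by (rule finite_subset) simp
  then show "set (sorted_list_of_set S) = set (filter (\<lambda>k. k \<in> S) [0..<n])"
    using assms by auto
qed (simp_all add: sorted_wrt_filter)

text \<open>Positions in \<open>listing r multi_indices\<close> increase along \<open>r\<close>, so
  keeping the positions selected by \<open>S\<close> in their natural order already gives an
  increasing list for \<open>r\<close>.\<close>

lemma listing_block_columns:
  fixes r :: "'n::{finite,linorder} set rel"
  assumes r: "linear_order_on multi_indices r"
  shows "listing r (block_columns r S j) = map ((!) (listing r multi_indices))
    (filter (\<lambda>k. j * 2 ^ (CARD('n) - 1) + k \<in> S) [0..<2 ^ (CARD('n) - 1)])"
proof (rule listing_eqI)
  let ?m = "2 ^ (CARD('n) - 1) :: nat"
  let ?L = "listing r multi_indices"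
  note L = distinct_listing [OF r finite subset_refl] sorted_listing [OF r finite subset_refl]
    length_listing [OF r finite subset_refl, unfolded card_multi_indices]
  show "antisym r" using r by (auto simp: order_on_defs)
  show "distinct (map ((!) ?L) (filter (\<lambda>k. j * ?m + k \<in> S) [0..<?m]))"
    using L by (auto simp: distinct_map intro!: inj_on_nth)
  show "set (map ((!) ?L) (filter (\<lambda>k. j * ?m + k \<in> S) [0..<?m])) = block_columns r S j"
    by (auto simp: block_columns_def)
  have "sorted_wrt (\<lambda>a b. (a, b) \<in> r) (map ((!) ?L) [0..<?m])"
    using L map_nth [of ?L] by simp
  then show "sorted_wrt (\<lambda>a b. (a, b) \<in> r) (map ((!) ?L) (filter (\<lambda>k. j * ?m + k \<in> S) [0..<?m]))"
    unfolding sorted_wrt_map by (rule sorted_wrt_filter)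
qed

text \<open>Increasing column numbers are ordered first by block and then by position, which is
  exactly the order of the concatenated listings. This is why no column permutation, and no sign for
  one, appears.\<close>

lemma columns_by_block:
  fixes r :: "'n::{finite,linorder} set rel"
  defines "m \<equiv> 2 ^ (CARD('n) - 1)"
  assumes r: "linear_order_on multi_indices r" and S: "S \<subseteq> {..<N * m}"
  shows "map (\<lambda>k. (k div m, listing r multi_indices ! (k mod m))) (sorted_list_of_set S) =
    concat (map (\<lambda>j. map (Pair j) (listing r (block_columns r S j))) [0..<N])"
proof -
  let ?col = "\<lambda>k. (k div m, listing r multi_indices ! (k mod m))"
  have "map ?col (filter (\<lambda>k. k \<in> S) (map (\<lambda>k. j * m + k) [0..<m])) =
      map (Pair j) (listing r (block_columns r S j))" for j
    unfolding listing_block_columns [OF r] m_def [symmetric] filter_map by (simp add: o_def)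
  then show ?thesis
    unfolding sorted_list_of_set_conv_filter [OF S] upt_mult_concat
    by (simp only: filter_concat map_concat map_map o_def)
qed

lemma det_select_cols_block_matrix:
  fixes r :: "'n::{finite,linorder} set rel" and f :: "nat \<Rightarrow> 'n paravector \<Rightarrow> 'n clifford"
  defines "m \<equiv> 2 ^ (CARD('n) - 1)"
  assumes r: "linear_order_on multi_indices r" and S: "S \<subseteq> {..<N * m}" "card S = m"
  shows "Determinant.det (select_cols (block_matrix r N f z) S) =
    (\<Sum>R\<in>ordered_partitions N multi_indices (\<lambda>j. card (block_columns r S j)).
      of_int (partition_sign r N R) * (\<Prod>j<N. minor r (f j) z (R j) (block_columns r S j)))"
proof -
  let ?L = "listing r multi_indices"
  let ?M = "\<lambda>a (j, b). matrix_entry (f j) z a b"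
  let ?C = "\<lambda>j. listing r (block_columns r S j)"
  let ?col = "\<lambda>k. (k div m, ?L ! (k mod m))"
  have fS: "finite S" using S(1) by (rule finite_subset) simp
  have len_L: "length ?L = m"
    using length_listing [OF r finite subset_refl] by (simp add: card_multi_indices m_def)
  have C_sub: "block_columns r S j \<subseteq> multi_indices" for j
    using len_L set_listing [OF r finite subset_refl] nth_mem [of _ ?L]
    by (auto simp: block_columns_def m_def)
  have len_C: "length (?C j) = card (block_columns r S j)" for j
    by (rule length_listing [OF r finite C_sub])
  have cols: "map ?col (sorted_list_of_set S) = concat (map (\<lambda>j. map (Pair j) (?C j)) [0..<N])"
    using columns_by_block [OF r] S(1) by (simp add: m_def)
  \<comment> \<open>That the block sizes add up to the number of rows is read off from the
    concatenated list, which has one entry for each element of \<open>S\<close>.\<close>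
  have "(\<Sum>j<N. length (?C j)) = length (concat (map (\<lambda>j. map (Pair j) (?C j)) [0..<N]))"
    by (simp add: length_concat o_def interv_sum_list_conv_sum_set_nat atLeast0LessThan)
  also have "\<dots> = card (multi_indices :: 'n set set)"
    using S(2) by (simp add: cols [symmetric] card_multi_indices m_def)
  finally have sum_C: "(\<Sum>j<N. length (?C j)) = card (multi_indices :: 'n set set)" .
  have "sorted_list_of_set S ! k < N * m" if "k < m" for k
    using nth_mem [of k "sorted_list_of_set S"] S fS that by auto
  moreover have "block_matrix r N f z =
      Matrix.mat m (N * m) (\<lambda>(i, k). matrix_entry (f (k div m)) z (?L ! i) (?L ! (k mod m)))"
    unfolding block_matrix_def Let_def m_def ..
  moreover have "length (sorted_list_of_set S) = m" using S(2) by simp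
  ultimately have "select_cols (block_matrix r N f z) S =
      indexed_mat ?M ?L (map ?col (sorted_list_of_set S))"
    unfolding indexed_mat_def S(2) length_map len_L by (intro eq_matI) simp_all
  then have "Determinant.det (select_cols (block_matrix r N f z) S) =
      Determinant.det (indexed_mat ?M ?L (concat (map (\<lambda>j. map (Pair j) (?C j)) [0..<N])))"
    by (simp only: cols)
  also have "\<dots> = (\<Sum>R\<in>ordered_partitions N multi_indices (\<lambda>j. length (?C j)).
      of_int (partition_sign r N R) *
      (\<Prod>j<N. Determinant.det (indexed_mat (\<lambda>a b. ?M a (j, b)) (listing r (R j)) (?C j))))"
    by (rule Laplace_expansion_blocks [OF r finite sum_C])
  also have "\<dots> = (\<Sum>R\<in>ordered_partitions N multi_indices (\<lambda>j. card (block_columns r S j)).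
      of_int (partition_sign r N R) * (\<Prod>j<N. minor r (f j) z (R j) (block_columns r S j)))"
    unfolding len_C
  proof (intro sum.cong prod.cong refl arg_cong2 [where f = "(*)"])
    fix R :: "nat \<Rightarrow> 'n set set" and j
    assume "R \<in> ordered_partitions N multi_indices (\<lambda>j. card (block_columns r S j))"
      and "j \<in> {..<N}"
    then have "R j \<subseteq> multi_indices" by (auto simp: ordered_partitions_def)
    then have "length (listing r (R j)) = card (R j)" by (rule length_listing [OF r finite])
    then show "Determinant.det (indexed_mat (\<lambda>a b. ?M a (j, b)) (listing r (R j)) (?C j)) =
        minor r (f j) z (R j) (block_columns r S j)"
      by (simp add: indexed_mat_def minor_def len_C)
  qed
  finally show ?thesis .
qed

theorem theorem7p7:
  fixes f :: "nat \<Rightarrow> 'n paravector \<Rightarrow> 'n::{finite,linorder} clifford"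
    and N :: nat
    and r :: "'n set rel"
  assumes "CARD('n) \<ge> 2"
    and "N > 0"
    and "linear_order_on multi_indices r"
    and "\<And>j. j < N \<Longrightarrow> slice_monogenic (f j)"
    and "\<And>j. j < N \<Longrightarrow> bounded (f j ` ball 0 1)"
  shows "(\<forall>i < 2 ^ (CARD('n) - 1). \<forall>k < N * 2 ^ (CARD('n) - 1).
        (\<lambda>z. block_matrix r N f z $$ (i, k)) \<in> H_infinity) \<and>
    (\<forall>z\<in>ball 0 1.
      Determinant.det (block_matrix r N f z * mat_adjoint (block_matrix r N f z)) =
        complex_of_real
          (\<Sum>S | S \<subseteq> {..<N * 2 ^ (CARD('n) - 1)} \<and> card S = 2 ^ (CARD('n) - 1).
            (cmod (\<Sum>R\<in>ordered_partitions N multi_indices (\<lambda>j. card (block_columns r S j)).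
              of_int (partition_sign r N R) *
              (\<Prod>j<N. minor r (f j) z (R j) (block_columns r S j))))\<^sup>2)) \<and>
    card {S. S \<subseteq> {..<N * 2 ^ (CARD('n) - 1)} \<and> card S = 2 ^ (CARD('n) - 1)} =
      (N * 2 ^ (CARD('n) - 1)) choose (2 ^ (CARD('n) - 1)) \<and>
    (\<forall>z\<in>ball 0 1.
      positive_semidefinite (block_matrix r N f z * mat_adjoint (block_matrix r N f z)))"
proof (intro conjI allI impI ballI)
  let ?m = "2 ^ (CARD('n) - 1) :: nat"
  let ?L = "listing r multi_indices"
  note r = assms(3)
  have carrier: "block_matrix r N f z \<in> carrier_mat ?m (N * ?m)" for z
    by (simp add: block_matrix_def Let_def)
  have L: "?L ! i \<in> multi_indices" if "i < ?m" for i
    using that nth_mem [of i ?L] length_listing [OF r finite subset_refl]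
      set_listing [OF r finite subset_refl] by (simp add: card_multi_indices)
  show "(\<lambda>z. block_matrix r N f z $$ (i, k)) \<in> H_infinity" if "i < ?m" "k < N * ?m" for i k
  proof -
    have "k div ?m < N" using that(2) by (simp add: less_mult_imp_div_less)
    then have "(\<lambda>z. matrix_entry (f (k div ?m)) z (?L ! i) (?L ! (k mod ?m))) \<in> H_infinity"
      using assms(4,5) L that by (intro matrix_entry_H_infinity) simp_all
    with that show ?thesis by (simp add: block_matrix_def Let_def)
  qed
  show "Determinant.det (block_matrix r N f z * mat_adjoint (block_matrix r N f z)) =
      complex_of_real (\<Sum>S | S \<subseteq> {..<N * ?m} \<and> card S = ?m.
        (cmod (\<Sum>R\<in>ordered_partitions N multi_indices (\<lambda>j. card (block_columns r S j)).
          of_int (partition_sign r N R) *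
          (\<Prod>j<N. minor r (f j) z (R j) (block_columns r S j))))\<^sup>2)" for z
    \<comment> \<open>Cauchy-Binet leaves a sum over the same sets \<open>S\<close>, so the Laplace
      expansion is applied inside each squared modulus.\<close>
    unfolding det_mult_adjoint [OF carrier]
  proof (intro arg_cong [where f = complex_of_real] sum.cong refl)
    fix S assume "S \<in> {S. S \<subseteq> {..<N * ?m} \<and> card S = ?m}"
    then have S: "S \<subseteq> {..<N * ?m}" "card S = ?m" by simp_all
    show "(cmod (Determinant.det (select_cols (block_matrix r N f z) S)))\<^sup>2 =
        (cmod (\<Sum>R\<in>ordered_partitions N multi_indices (\<lambda>j. card (block_columns r S j)).
          of_int (partition_sign r N R) *
          (\<Prod>j<N. minor r (f j) z (R j) (block_columns r S j))))\<^sup>2"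
      by (simp only: det_select_cols_block_matrix [OF r S])
  qed
  show "card {S. S \<subseteq> {..<N * ?m} \<and> card S = ?m} = (N * ?m) choose ?m"
    using n_subsets [of "{..<N * ?m}" ?m] by simp
  show "positive_semidefinite (block_matrix r N f z * mat_adjoint (block_matrix r N f z))" for z
    by (rule positive_semidefinite_mult_adjoint [OF carrier])
qed

end
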